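(* Let $a,b,c,d,q\in\mathbb{C}$ with $|q|<1$ be generic and let $\lambda\in\mathbb{Z}_{\ge0}$. Then the Askey–Wilson polynomial satisfies $$p_\lambda(x)=(abcdq^{\lambda-1};q)_\lambda\sum_{(k,l,m,n)\in\mathcal{P}_\lambda}c_e(k,l;q^{m+n-\lambda})\,c_o(m,n;q^{-\lambda})\,x^{-\lambda+2k+2l+m+n},$$ where $\mathcal{P}_\lambda$ is the finite set of $(k,l,m,n)\in(\mathbb{Z}_{\ge0})^4$ with $0\le m\le\lambda$, $0\le n\le\lambda-m$, $0\le 2l\le\lambda-m-n$, $0\le k\le\lambda-2l-m-n$.
   Context: Notation: $(a_1,\dots,a_k;q)_n=\prod_{j=1}^k\prod_{i=0}^{n-1}(1-q^ia_j)$ and ${}_{4}\phi_3\left[{a_1,\dots,a_{4}\atop b_1,b_2,b_3};q,z\right]=\sum_{m\ge0}\frac{(a_1,\dots,a_4;q)_m}{(q,b_1,b_2,b_3;q)_m}z^m$. The Askey–Wilson polynomial is $$p_n(x)=a^{-n}(ab,ac,ad;q)_n\,{}_4\phi_3\left[{q^{-n},abcdq^{n-1},ax,a/x\atop ab,ac,ad};q,q\right].$$ Define $$c_e(k,l;s)=\frac{(a^2;q^2)_k(q^{4l}s^2;q^2)_k}{(q^2;q^2)_k(q^{4l+2}s^2/a^2;q^2)_k}\Big(\frac{q^2}{a^2}\Big)^k\cdot\frac{(c^2/q;q^2)_l(s^2/a^2;q^2)_l}{(q^2;q^2)_l(q^3s^2/a^2c^2;q^2)_l}\cdot\frac{(s;q)_{2l}(q^2s^2/a^4;q^2)_{2l}}{(qs/a^2;q)_{2l}(s^2/a^2;q^2)_{2l}}\Big(\frac{q^2}{c^2}\Big)^l,$$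 $$c_o(m,n;s)=\frac{(-b/a;q)_m(s;q)_m(qs/cd;q)_m(qs^2/a^2c^2;q)_m}{(q;q)_m(q^2s^2/abcd;q)_m(qs^2/a^2c^2;q^2)_m}\Big(\frac{q}{b}\Big)^m\cdot\frac{(-d/c;q)_n(q^ms;q)_n(qs/ab;q)_n(-q^{m+1}s/ac;q)_n(q^{m+1}s^2/a^2c^2;q)_n}{(q;q)_n(q^{m+2}s^2/abcd;q)_n(-qs/ac;q)_n(q^{2m+1}s^2/a^2c^2;q^2)_n}\Big(\frac{q}{d}\Big)^n.$$ *)

theory Defs
  imports Complex_Main
begin

definition qpoch :: "complex \<Rightarrow> complex \<Rightarrow> nat \<Rightarrow> complex" where
  "qpoch q a n = (\<Prod>i<n. 1 - q ^ i * a)"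

text \<open>The multi-parameter symbol \<open>(a\<^sub>1,\<dots>,a\<^sub>k;q)\<^sub>n\<close>, with the parameters given as a list.\<close>

definition qpochs :: "complex \<Rightarrow> complex list \<Rightarrow> nat \<Rightarrow> complex" where
  "qpochs q as n = (\<Prod>a\<leftarrow>as. qpoch q a n)"

definition phi43 ::
  "complex \<Rightarrow> complex \<Rightarrow> complex \<Rightarrow> complex \<Rightarrow> complex \<Rightarrow> complex \<Rightarrow> complex \<Rightarrow> complex \<Rightarrow> complex \<Rightarrow> complex"
  where
  "phi43 a1 a2 a3 a4 b1 b2 b3 q z =
    (\<Sum>m. qpochs q [a1, a2, a3, a4] m / qpochs q [q, b1, b2, b3] m * z ^ m)"

definition askey_wilson ::
  "complex \<Rightarrow> complex \<Rightarrow> complex \<Rightarrow> complex \<Rightarrow> complex \<Rightarrow> nat \<Rightarrow> complex \<Rightarrow> complex" where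
  "askey_wilson a b c d q n x =
    a powi (- int n) * qpochs q [a*b, a*c, a*d] n *
    phi43 (q powi (- int n)) (a*b*c*d * q powi (int n - 1)) (a*x) (a/x)
          (a*b) (a*c) (a*d) q q"

definition c_e :: "complex \<Rightarrow> complex \<Rightarrow> complex \<Rightarrow> nat \<Rightarrow> nat \<Rightarrow> complex \<Rightarrow> complex" where
  "c_e a c q k l s =
    (qpoch (q^2) (a^2) k * qpoch (q^2) (q^(4*l) * s^2) k)
      / (qpoch (q^2) (q^2) k * qpoch (q^2) (q^(4*l+2) * s^2 / a^2) k)
      * (q^2 / a^2) ^ k
    * ((qpoch (q^2) (c^2 / q) l * qpoch (q^2) (s^2 / a^2) l)
      / (qpoch (q^2) (q^2) l * qpoch (q^2) (q^3 * s^2 / (a^2 * c^2)) l))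
    * ((qpoch q s (2*l) * qpoch (q^2) (q^2 * s^2 / a^4) (2*l))
      / (qpoch q (q * s / a^2) (2*l) * qpoch (q^2) (s^2 / a^2) (2*l)))
      * (q^2 / c^2) ^ l"

definition c_o ::
  "complex \<Rightarrow> complex \<Rightarrow> complex \<Rightarrow> complex \<Rightarrow> complex \<Rightarrow> nat \<Rightarrow> nat \<Rightarrow> complex \<Rightarrow> complex" where
  "c_o a b c d q m n s =
    (qpoch q (- b / a) m * qpoch q s m * qpoch q (q * s / (c*d)) m
        * qpoch q (q * s^2 / (a^2 * c^2)) m)
      / (qpoch q q m * qpoch q (q^2 * s^2 / (a*b*c*d)) m
        * qpoch (q^2) (q * s^2 / (a^2 * c^2)) m)
      * (q / b) ^ m
    * ((qpoch q (- d / c) n * qpoch q (q^m * s) n * qpoch q (q * s / (a*b)) n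
        * qpoch q (- (q^(m+1) * s / (a*c))) n * qpoch q (q^(m+1) * s^2 / (a^2 * c^2)) n)
      / (qpoch q q n * qpoch q (q^(m+2) * s^2 / (a*b*c*d)) n
        * qpoch q (- (q * s / (a*c))) n
        * qpoch (q^2) (q^(2*m+1) * s^2 / (a^2 * c^2)) n))
      * (q / d) ^ n"

definition P_set :: "nat \<Rightarrow> (nat \<times> nat \<times> nat \<times> nat) set" where
  "P_set lam = {(k, l, m, n). m \<le> lam \<and> m + n \<le> lam \<and> 2*l + m + n \<le> lam \<and> k + 2*l + m + n \<le> lam}"

text \<open>
  Genericity is made explicit as the condition that no denominator in the expansion vanishes, for any degree.
  In \<open>c_e\<close> (at \<open>s = q\<^sup>m\<^sup>+\<^sup>n\<^sup>-\<^sup>\<lambda>\<close>) and \<open>c_o\<close> (at \<open>s = q\<^sup>-\<^sup>\<lambda>\<close>) over the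
  summation range, and in the hypergeometric series, the denominators vanish exactly when one of
  \<open>a\<^sup>2\<close>, \<open>ab\<close>, \<open>ad\<close>, \<open>\<plusminus>ac\<close>, \<open>abcd\<close> is a power \<open>q\<^sup>-\<^sup>j\<close>, \<open>j \<ge> 0\<close>, or \<open>a\<^sup>2c\<^sup>2\<close>
  is such a power with \<open>j\<close> odd; the conditions on \<open>\<plusminus>ac\<close> are those on \<open>a\<^sup>2c\<^sup>2\<close> with \<open>j\<close> even.
\<close>

definition aw_generic ::
  "complex \<Rightarrow> complex \<Rightarrow> complex \<Rightarrow> complex \<Rightarrow> complex \<Rightarrow> bool" where
  "aw_generic a b c d q \<longleftrightarrow>
    a \<noteq> 0 \<and> b \<noteq> 0 \<and> c \<noteq> 0 \<and> d \<noteq> 0 \<and> q \<noteq> 0 \<and>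
    (\<forall>j::nat. a^2 * q^j \<noteq> 1 \<and> a*b * q^j \<noteq> 1 \<and> a*d * q^j \<noteq> 1 \<and>
      a*b*c*d * q^j \<noteq> 1 \<and> a^2 * c^2 * q^j \<noteq> 1)"

end

theory Submission
  imports Defs
begin

text \<open>
  Put \<open>X = x + 1/x\<close>. The monic Askey--Wilson polynomials \<open>P\<^sub>j\<close> with the parameters
  \<open>(a, -a, c, -c)\<close> satisfy \<open>P\<^sub>j\<^sub>+\<^sub>2 = X P\<^sub>j\<^sub>+\<^sub>1 - \<gamma>\<^sub>j P\<^sub>j\<close>, and they
  separate the two factors of the expansion: \<open>c\<^sub>e\<close> gives their coefficients in powers of \<open>x\<close>,
  and \<open>c\<^sub>o\<close> those of \<open>p\<^sub>\<lambda>\<close> in the \<open>P\<^sub>j\<close>.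

  For \<open>c\<^sub>e\<close>, expand \<open>P\<^sub>N\<close> in the monic Rogers polynomials of base \<open>q\<^sup>2\<close> and parameter \<open>a\<^sup>2\<close>
  (the case \<open>c\<^sup>2 = q\<close>), whose coefficients are explicit; the connection coefficients are verified by
  comparing three-term recurrences.

  For \<open>c\<^sub>o\<close>, expand \<open>(ax, a/x; q)\<^sub>k\<close> in the \<open>P\<^sub>j\<close>, by induction on \<open>k\<close> using the three-term recurrence,
  and substitute into the \<open>\<^sub>4\<phi>\<^sub>3\<close> series of \<open>p\<^sub>\<lambda>\<close>. The coefficient of \<open>P\<^sub>j\<close> is a balanced terminating
  \<open>\<^sub>4\<phi>\<^sub>3\<close>, which Sears' transformation turns into the sum of \<open>c\<^sub>o\<close> over \<open>m + n = \<lambda> - j\<close>.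
  Genericity does not keep intermediate denominators such as \<open>(-a\<^sup>2; q)\<^sub>k\<close> from vanishing, so the
  summation formulas are needed with denominators cleared, as polynomial identities.
\<close>

section \<open>Finite q-shifted factorials\<close>

lemma qpoch_0 [simp]: "qpoch q a 0 = 1"
  and qpoch_Suc: "qpoch q a (Suc n) = qpoch q a n * (1 - q ^ n * a)"
  by (simp_all add: qpoch_def)

lemma qpoch_add: "qpoch q a (m + n) = qpoch q a m * qpoch q (q ^ m * a) n"
  by (induction n) (simp_all add: qpoch_Suc power_add mult_ac)

lemma qpoch_Suc_left: "qpoch q a (Suc n) = (1 - a) * qpoch q (q * a) n"
  using qpoch_add[of q a 1 n] by (simp add: qpoch_Suc)

lemma qpoch_eq_0_iff: "qpoch q a n = 0 \<longleftrightarrow> (\<exists>i<n. q ^ i * a = 1)"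
  by (auto simp: qpoch_def)

lemma qpoch_mult_minus: "qpoch q a n * qpoch q (- a) n = qpoch (q\<^sup>2) (a\<^sup>2) n"
  by (induction n) (simp_all add: qpoch_Suc algebra_simps power2_eq_square power_mult_distrib)

lemma choose_two_Suc: "Suc n choose 2 = (n choose 2) + n"
  by (simp add: numeral_2_eq_2)

text \<open>The hypothesis says \<open>v = q\<^sup>1\<^sup>-\<^sup>n / w\<close>, free of a negative power.\<close>
lemma qpoch_reverse:
  assumes "w * v * q ^ n = q" "q \<noteq> 0"
  shows "qpoch q w n = (- w) ^ n * q ^ (n choose 2) * qpoch q v n"
  using assms(1)
proof (induction n arbitrary: v)
  case (Suc n)
  have wv: "w * v * q ^ n = 1"
    using Suc.prems assms(2) by (simp add: mult_ac)
  have "qpoch q w n = (- w) ^ n * q ^ (n choose 2) * qpoch q (q * v) n"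
    by (rule Suc.IH) (use wv in \<open>simp add: algebra_simps\<close>)
  moreover have "1 - q ^ n * w = - w * q ^ n * (1 - v)"
    using wv by (simp add: algebra_simps)
  ultimately show ?case
    unfolding qpoch_Suc[of q w] qpoch_Suc_left[of q v] choose_two_Suc
    by (simp add: power_add)
qed (simp add: numeral_2_eq_2)

lemma sum_triangle_shift:
  "(\<Sum>i\<le>r. \<Sum>m\<le>i. f i m) = (\<Sum>m\<le>r. \<Sum>u\<le>r - m. f (m + u) m)" for r :: nat
  unfolding sum.Sigma[OF finite_atMost ballI[OF finite_atMost]]
  by (rule sum.reindex_bij_witness[where i = "\<lambda>(m, u). (m + u, m)" and j = "\<lambda>(i, m). (m, i - m)"]) auto

section \<open>Gaussian binomial coefficients\<close>

text \<open>For \<open>k > n\<close> truncated subtraction would leave a nonzero quotient. The value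
  0 there lets sums run past \<open>n\<close> and settles the boundary cases of the Pascal
  rules.\<close>

definition qbinom :: "complex \<Rightarrow> nat \<Rightarrow> nat \<Rightarrow> complex" where
  "qbinom q n k = (if k \<le> n then qpoch q q n / (qpoch q q k * qpoch q q (n - k)) else 0)"

text \<open>The base is nonzero and not a root of unity. A locale serves because the Rogers
  polynomials are used in base q^2, for which it is instantiated again.\<close>

locale qbase =
  fixes q :: complex
  assumes q_nonzero: "q \<noteq> 0" and q_power_neq_1: "0 < n \<Longrightarrow> q ^ n \<noteq> 1"
begin

lemma qpoch_q_nonzero [simp]: "qpoch q q n \<noteq> 0"
  using q_power_neq_1[of "Suc _"] by (auto simp: qpoch_eq_0_iff power_commutes)

lemma q_power_Suc_neq_1 [simp]: "q * q ^ n \<noteq> 1" "q ^ n * q \<noteq> 1"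
  using q_power_neq_1[of "Suc n"] by (simp_all add: mult.commute)

lemma q_power_add_neq_1 [simp]: "q * (q ^ m * q ^ n) \<noteq> 1"
  using q_power_neq_1[of "Suc (m + n)"] by (simp add: power_add)

lemma qbinom_0 [simp]: "qbinom q n 0 = 1"
  and qbinom_self [simp]: "qbinom q n n = 1"
  by (simp_all add: qbinom_def)

lemma qbinom_Suc_Suc:
  "qbinom q (Suc n) (Suc k) = qbinom q n k + q ^ Suc k * qbinom q n (Suc k)"
proof (cases "k < n")
  case True
  then obtain i where n: "n = Suc (k + i)"
    using less_imp_Suc_add by blast
  show ?thesis
    by (simp add: n qbinom_def qpoch_Suc divide_simps) (simp add: algebra_simps power_add)
qed (auto simp: qbinom_def not_less qpoch_Suc)

lemma qbinom_Suc_Suc':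
  assumes "k \<le> n"
  shows "qbinom q (Suc n) (Suc k) = q ^ (n - k) * qbinom q n k + qbinom q n (Suc k)"
proof (cases "k < n")
  case True
  then obtain i where n: "n = Suc (k + i)"
    using less_imp_Suc_add by blast
  show ?thesis
    by (simp add: n qbinom_def qpoch_Suc divide_simps) (simp add: algebra_simps power_add)
qed (use assms in \<open>auto simp: qbinom_def\<close>)

lemma qbinom_trinomial:
  assumes "m \<le> i" "i \<le> r"
  shows "qbinom q r i * qbinom q i m = qbinom q r m * qbinom q (r - m) (i - m)"
proof -
  have "r - m - (i - m) = r - i" using assms by simp
  then show ?thesis using assms by (simp add: qbinom_def)
qed

section \<open>Balanced terminating series: the q-Saalschuetz sum and Sears' transformation\<close>

text \<open>The k-th term of the balanced 3phi2 with upper parameters q^(-n), a, b, lower parameters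
  abe, q^(1-n)/e and argument q, multiplied by (abe, e; q)_n. This product absorbs all denominators
  that involve a, b or e.\<close>

definition saal :: "complex \<Rightarrow> complex \<Rightarrow> complex \<Rightarrow> nat \<Rightarrow> nat \<Rightarrow> complex" where
  "saal a b e n k = qbinom q n k * qpoch q a k * qpoch q b k *
     qpoch q (a * b * e * q ^ k) (n - k) * qpoch q e (n - k) * e ^ k"

text \<open>Creative telescoping in \<open>n\<close>: with G(k) = (1 - a q^k)(1 - b q^k) e q^(n-k)
  \<open>saal a b e n k\<close>, the last two terms are -G(k+1) + G(k). Summation over
  \<open>k\<close> leaves a first-order recurrence in \<open>n\<close>.\<close>

lemma saal_Suc_Suc:
  assumes "k \<le> n"
  shows "saal a b e (Suc n) (Suc k) =
    (1 - a * e * q ^ n) * (1 - b * e * q ^ n) * saal a b e n (Suc k)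
    - (1 - a * q ^ Suc k) * (1 - b * q ^ Suc k) * e * q ^ (n - Suc k) * saal a b e n (Suc k)
    + (1 - a * q ^ k) * (1 - b * q ^ k) * e * q ^ (n - k) * saal a b e n k"
proof (cases "k < n")
  case False
  then show ?thesis using assms by (simp add: saal_def qpoch_Suc qbinom_def mult_ac)
next
  case True
  then obtain i where n: "n = Suc (k + i)"
    using less_imp_Suc_add by blast
  let ?y = "a * b * e"
  \<comment> \<open>The factor has two terms. One Pascal rule, \<open>qbinom_Suc_Suc'\<close>,
    serves for the 1 and the other, \<open>qbinom_Suc_Suc\<close>, for
    \<open>?y * q ^ n\<close>.\<close>
  have p: "qbinom q (Suc n) (Suc k) * (1 - ?y * q ^ n)
     = qbinom q n (Suc k) * (1 - ?y * q ^ (n + Suc k)) + qbinom q n k * q ^ (n - k) * (1 - ?y * q ^ k)"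
  proof -
    have "qbinom q (Suc n) (Suc k) * (1 - ?y * q ^ n) =
      (q ^ (n - k) * qbinom q n k + qbinom q n (Suc k))
      - ?y * q ^ n * (qbinom q n k + q ^ Suc k * qbinom q n (Suc k))"
      using qbinom_Suc_Suc[of n k] qbinom_Suc_Suc'[OF assms] by (simp add: algebra_simps)
    also have "\<dots> = qbinom q n (Suc k) * (1 - ?y * q ^ (n + Suc k)) + qbinom q n k * q ^ (n - k) *
        (1 - ?y * q ^ k)"
      by (simp add: n algebra_simps power_add)
    finally show ?thesis .
  qed
  have y: "qpoch q (?y * q ^ k) (Suc i) = (1 - ?y * q ^ k) * qpoch q (?y * q ^ Suc k) i"
    by (simp add: qpoch_Suc_left mult_ac)
  \<comment> \<open>Balancedness enters here: the difference factors because the lower parameter is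
    the product abe.\<close>
  have f1: "(1 - a * e * q ^ n) * (1 - b * e * q ^ n)
      - (1 - a * q ^ Suc k) * (1 - b * q ^ Suc k) * e * q ^ i
      = (1 - e * q ^ i) * (1 - ?y * q ^ (n + Suc k))"
    by (simp add: n algebra_simps power_add)
  let ?K = "qpoch q a (Suc k) * qpoch q b (Suc k) * qpoch q (?y * q ^ Suc k) i * qpoch q e (Suc i) *
      e ^ Suc k"
  have s1: "saal a b e (Suc n) (Suc k) = ?K * (qbinom q (Suc n) (Suc k) * (1 - ?y * q ^ n))"
    by (simp add: saal_def n qpoch_Suc[of q "_ * _" i] power_add mult_ac)
  have s2: "(1 - e * q ^ i) * saal a b e n (Suc k) = ?K * qbinom q n (Suc k)"
    by (simp add: saal_def n qpoch_Suc[of q e i] mult_ac)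
  have s3: "(1 - a * q ^ k) * (1 - b * q ^ k) * e * saal a b e n k
       = ?K * qbinom q n k * (1 - ?y * q ^ k)"
    using y by (simp add: saal_def n qpoch_Suc[of q _ k] mult_ac)
  have "saal a b e (Suc n) (Suc k) = (1 - ?y * q ^ (n + Suc k)) * ((1 - e * q ^ i) *
      saal a b e n (Suc k))
      + q ^ (n - k) * ((1 - a * q ^ k) * (1 - b * q ^ k) * e * saal a b e n k)"
    unfolding s1 p s2 s3 by (simp add: algebra_simps)
  also have "\<dots> = ((1 - a * e * q ^ n) * (1 - b * e * q ^ n)
      - (1 - a * q ^ Suc k) * (1 - b * q ^ Suc k) * e * q ^ i) * saal a b e n (Suc k)
      + q ^ (n - k) * ((1 - a * q ^ k) * (1 - b * q ^ k) * e * saal a b e n k)"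
    unfolding f1 by (simp add: mult_ac)
  finally show ?thesis
    by (simp add: n algebra_simps)
qed

lemma saal_Suc_0:
  "saal a b e (Suc n) 0 = (1 - a * e * q ^ n) * (1 - b * e * q ^ n) * saal a b e n 0
     - (1 - a) * (1 - b) * e * q ^ n * saal a b e n 0"
  by (simp add: saal_def qpoch_Suc algebra_simps power_add)

text \<open>The \<open>q\<close>-Saalschuetz sum for a balanced terminating \<open>\<^sub>3\<phi>\<^sub>2\<close>, with denominators cleared
  so that no parameter is excluded.\<close>
theorem q_saalschuetz: "(\<Sum>k\<le>n. saal a b e n k) = qpoch q (a * e) n * qpoch q (b * e) n"
proof (induction n)
  case (Suc n)
  define G where "G k = (1 - a * q ^ k) * (1 - b * q ^ k) * e * q ^ (n - k) * saal a b e n k" for k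
  let ?c = "(1 - a * e * q ^ n) * (1 - b * e * q ^ n)"
  have last: "saal a b e n (Suc n) = 0"
    by (simp add: saal_def qbinom_def)
  have "(\<Sum>k\<le>Suc n. saal a b e (Suc n) k) = saal a b e (Suc n) 0 + (\<Sum>k\<le>n. saal a b e (Suc n) (Suc k))"
    by (rule sum.atMost_Suc_shift)
  also have "\<dots> = ?c * saal a b e n 0 - G 0 + (\<Sum>k\<le>n. ?c * saal a b e n (Suc k) - G (Suc k) + G k)"
    using saal_Suc_0 saal_Suc_Suc by (simp add: G_def)
  also have "\<dots> = ?c * (saal a b e n 0 + (\<Sum>k\<le>n. saal a b e n (Suc k)))
      - (G 0 + (\<Sum>k\<le>n. G (Suc k))) + (\<Sum>k\<le>n. G k)"
    by (simp add: sum.distrib sum_subtractf sum_distrib_left algebra_simps)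
  also have "\<dots> = ?c * (\<Sum>k\<le>Suc n. saal a b e n k) - (\<Sum>k\<le>Suc n. G k) + (\<Sum>k\<le>n. G k)"
    by (simp only: sum.atMost_Suc_shift)
  also have "\<dots> = ?c * (\<Sum>k\<le>n. saal a b e n k)"
    by (simp add: last G_def)
  finally show ?case
    using Suc by (simp add: qpoch_Suc mult_ac)
qed (simp add: saal_def)

text \<open>The left side is the balanced 4phi3 with upper parameters q^(-r), B, C, D and lower
  parameters BCt, Dh, q^(1-r)/(th), cleared of denominators. Expanding (B, C; q)_i by q-Saalschuetz
  and exchanging the sums leaves an inner sum that is q-Saalschuetz again.\<close>

theorem sears_transformation:
  assumes "t \<noteq> 0"
  shows "(\<Sum>i\<le>r. qbinom q r i * qpoch q B i * qpoch q C i * qpoch q D i *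
      qpoch q (B * C * t * q ^ i) (r - i) * qpoch q (D * h * q ^ i) (r - i) *
      qpoch q (t * h) (r - i) * (t * h) ^ i) =
    (\<Sum>m\<le>r. qbinom q r m * qpoch q D m * qpoch q (C * t) m * qpoch q (B * t) m *
      qpoch q (B * C * t * q ^ m) (r - m) * qpoch q (D * t * h * q ^ m) (r - m) *
      qpoch q h (r - m) * h ^ m)" (is "?L = ?R")
proof -
  define Y where "Y i = qpoch q D i * qpoch q (D * h * q ^ i) (r - i) *
      qpoch q (t * h) (r - i) * (t * h) ^ i" for i
  define Z where "Z m = qpoch q (B * t) m * qpoch q (C * t) m * qpoch q (B * C * t * q ^ m) (r -
      m)" for m
  define X where "X i m = qbinom q r i * qbinom q i m * Z m *
      qpoch q (1 / t) (i - m) * (1 / t) ^ m * Y i" for i m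
  have BC: "qpoch q (B * C * t * q ^ m) (i - m) * qpoch q (B * C * t * q ^ i) (r - i) =
     qpoch q (B * C * t * q ^ m) (r - m)" if "m \<le> i" "i \<le> r" for m i
    using qpoch_add[of q "B * C * t * q ^ m" "i - m" "r - i"] that
    by (simp add: mult_ac flip: power_add)
  have "?L = (\<Sum>i\<le>r. qbinom q r i * (qpoch q B i * qpoch q C i) * qpoch q (B * C * t * q ^ i) (r -
      i) * Y i)"
    by (simp add: Y_def mult_ac)
  also have "\<dots> = (\<Sum>i\<le>r. \<Sum>m\<le>i. X i m)"
  proof (rule sum.cong[OF refl])
    fix i assume i: "i \<in> {..r}"
    \<comment> \<open>The parameters Bt, Ct, 1/t are chosen so that the sum evaluates to (B, C;
      q)_i, while their product is the lower parameter BCt.\<close>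
    have "qpoch q B i * qpoch q C i = (\<Sum>m\<le>i. saal (B * t) (C * t) (1 / t) i m)"
      using q_saalschuetz[of "B * t" "C * t" "1 / t" i] assms by simp
    then have "qbinom q r i * (qpoch q B i * qpoch q C i) * qpoch q (B * C * t * q ^ i) (r - i) * Y i =
      (\<Sum>m\<le>i. saal (B * t) (C * t) (1 / t) i m * (qbinom q r i * qpoch q (B * C * t * q ^ i) (r -
          i) * Y i))"
      by (simp add: sum_distrib_left sum_distrib_right mult_ac)
    also have "\<dots> = (\<Sum>m\<le>i. X i m)"
    proof (rule sum.cong[OF refl])
      fix m assume m: "m \<in> {..i}"
      have "B * t * (C * t) * (1 / t) = B * C * t" using assms by (simp add: field_simps)
      then show "saal (B * t) (C * t) (1 / t) i m * (qbinom q r i * qpoch q (B * C * t *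
          q ^ i) (r - i) * Y i) = X i m"
        using BC[of m i] m i
        by (simp add: saal_def X_def Z_def mult_ac)
    qed
    finally show "qbinom q r i * (qpoch q B i * qpoch q C i) * qpoch q (B * C * t * q ^ i) (r - i) *
        Y i = (\<Sum>m\<le>i. X i m)" .
  qed
  also have "\<dots> = (\<Sum>m\<le>r. \<Sum>u\<le>r - m. X (m + u) m)"
    by (rule sum_triangle_shift)
  also have "\<dots> = ?R"
  proof (rule sum.cong[OF refl])
    fix m assume m: "m \<in> {..r}"
    \<comment> \<open>After the shift i = m + u the inner sum has the parameters 1/t, q^m D,
      th.\<close>
    have X: "X (m + u) m = qbinom q r m * Z m * qpoch q D m * h ^ m *
        saal (1 / t) (q ^ m * D) (t * h) (r - m) u" if "u \<in> {..r - m}" for u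
      using qbinom_trinomial[of m "m + u" r] m that assms
      by (simp add: X_def Y_def saal_def qpoch_add[of q D m u] power_add power_mult_distrib
          power_divide field_simps)
    have "(\<Sum>u\<le>r - m. X (m + u) m) = qbinom q r m * Z m * qpoch q D m * h ^ m *
        (\<Sum>u\<le>r - m. saal (1 / t) (q ^ m * D) (t * h) (r - m) u)"
      unfolding sum_distrib_left by (rule sum.cong[OF refl X])
    also have "\<dots> = qbinom q r m * Z m * qpoch q D m * h ^ m *
       (qpoch q h (r - m) * qpoch q (D * t * h * q ^ m) (r - m))"
      using assms by (simp add: q_saalschuetz mult_ac)
    finally show "(\<Sum>u\<le>r - m. X (m + u) m) = qbinom q r m * qpoch q D m * qpoch q (C * t) m *
      qpoch q (B * t) m * qpoch q (B * C * t * q ^ m) (r - m) *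
      qpoch q (D * t * h * q ^ m) (r - m) * qpoch q h (r - m) * h ^ m"
      by (simp add: Z_def mult_ac)
  qed
  finally show ?thesis .
qed

end

section \<open>The polynomials with parameters (a, -a, c, -c)\<close>

lemma power_double: "x ^ (2 * n) = x ^ n * x ^ n" "x ^ (n * 2) = x ^ n * x ^ n"
  for x :: "'a::comm_monoid_mult"
  by (simp_all add: mult_2 mult_2_right power_add)

text \<open>\<open>\<gamma> n\<close> couples the degrees n and n + 2, so its index is one lower
  than in the convention where the coefficient of P_(n-1) in P_(n+1) is called gamma_n.\<close>

fun monic_rec :: "(nat \<Rightarrow> complex) \<Rightarrow> complex \<Rightarrow> nat \<Rightarrow> complex" where
  "monic_rec \<gamma> X 0 = 1"
| "monic_rec \<gamma> X (Suc 0) = X"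
| "monic_rec \<gamma> X (Suc (Suc n)) = X * monic_rec \<gamma> X (Suc n) - \<gamma> n * monic_rec \<gamma> X n"

lemma sum_times_monic_rec:
  "(\<Sum>j\<le>k. u j * (X * monic_rec \<gamma> X j)) =
   (\<Sum>j\<le>k. u j * monic_rec \<gamma> X (Suc j)) + (\<Sum>j<k. u (Suc j) * \<gamma> j * monic_rec \<gamma> X j)"
  by (induction k) (simp_all add: algebra_simps)

text \<open>\<open>ac_generic\<close> keeps the denominators of \<open>\<gamma>\<close> and
  \<open>U\<close> from vanishing, \<open>a_generic\<close> those of the Rogers polynomials with
  base q^2 and parameter a^2.\<close>

locale even_aw = qbase +
  fixes a c :: complex
  assumes a_nonzero: "a \<noteq> 0" and c_nonzero: "c \<noteq> 0"
    and ac_generic: "a\<^sup>2 * c\<^sup>2 * q ^ n \<noteq> 1"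
    and a_generic: "a\<^sup>2 * q ^ n \<noteq> 1"
begin

definition A :: complex where "A = a\<^sup>2 * c\<^sup>2"

lemma A_generic [simp]: "A * q ^ n \<noteq> 1" "q ^ n * A \<noteq> 1"
  using ac_generic by (simp_all add: A_def mult_ac)

lemma qpoch_A_nonzero [simp]: "qpoch q (A * q ^ m) n \<noteq> 0"
proof -
  have "q ^ i * (A * q ^ m) \<noteq> 1" for i
    using A_generic(1)[of "i + m"] by (simp add: power_add mult_ac)
  then show ?thesis by (simp add: qpoch_eq_0_iff)
qed

text \<open>The quotient cancels at \<open>n = 0\<close>, where it could be \<open>0 / 0\<close>: the case \<open>A = q\<close> is not excluded.\<close>
definition \<gamma>_aux :: "nat \<Rightarrow> complex" where
  "\<gamma>_aux n = (case n of 0 \<Rightarrow> 1 | Suc m \<Rightarrow> (1 - A * q ^ m) / (1 - A * q ^ (2 * m + 1)))"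

text \<open>The product A_n C_(n+1) of the classical Askey-Wilson recurrence coefficients at (a, -a,
  c, -c). For these parameters the middle coefficient of the recurrence is zero by the symmetry x ->
  -x.\<close>

definition \<gamma> :: "nat \<Rightarrow> complex" where
  "\<gamma> n = (1 - q ^ Suc n) * (1 + a\<^sup>2 * q ^ n) * (1 + c\<^sup>2 * q ^ n) * \<gamma>_aux n / (1 - A * q ^ (2 * n + 1))"

text \<open>The coefficient of \<open>P\<^sub>j\<close> in \<open>(ax, a/x; q)\<^sub>k\<close>.\<close>
definition U :: "nat \<Rightarrow> nat \<Rightarrow> complex" where
  "U k j = qbinom q k j * (- a) ^ j * q ^ (j choose 2) * qpoch q (- (a\<^sup>2) * q ^ j) (k - j) *
     qpoch (q\<^sup>2) (A * q ^ (2 * j)) (k - j) / qpoch q (A * q ^ (2 * j)) (k - j)"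

section \<open>Expansion of (ax, a/x; q)_k in the P_j\<close>

text \<open>The ratio of neighbouring entries of \<open>U\<close> in the direction of k, with k = j
  + n, kept cross-multiplied because factors such as 1 + a^2 q^i may vanish.
  \<open>U_Suc_right\<close> does the same in the direction of j.\<close>

lemma U_Suc_left:
  "U (Suc (j + n)) j * (1 - q ^ Suc n) * (1 - A * q ^ (2 * j + n)) =
    U (j + n) j * (1 - q ^ Suc (j + n)) * (1 + a\<^sup>2 * q ^ (j + n)) * (1 - A * q ^ (2 * (j + n)))"
proof -
  have "qpoch q (A * q ^ (2 * j)) (Suc n) = qpoch q (A * q ^ (2 * j)) n * (1 - A * q ^ (2 * j + n))"
    by (simp add: qpoch_Suc power_add mult_ac)
  then have d: "qpoch q (A * q ^ (2 * j)) n / qpoch q (A * q ^ (2 * j)) (Suc n) * (1 - A * q ^ (2 *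
      j + n)) = 1"
    by (simp add: divide_simps)
  have b: "qbinom q (Suc (j + n)) j * (1 - q ^ Suc n) = qbinom q (j + n) j * (1 - q ^ Suc (j + n))"
    by (simp add: qbinom_def qpoch_Suc Suc_diff_le field_simps power_add)
  have e: "q\<^sup>2 ^ n * (A * q ^ (2 * j)) = A * q ^ (2 * (j + n))"
    by (simp add: power_add power_mult power2_eq_square power_mult_distrib)
  let ?K = "(- a) ^ j * q ^ (j choose 2) * qpoch q (- (a\<^sup>2) * q ^ j) n * qpoch (q\<^sup>2) (A * q ^ (2 * j)) n
     * (1 + a\<^sup>2 * q ^ (j + n)) * (1 - A * q ^ (2 * (j + n)))"
  have "U (Suc (j + n)) j * (1 - q ^ Suc n) * (1 - A * q ^ (2 * j + n)) =
    ?K * (qbinom q (Suc (j + n)) j * (1 - q ^ Suc n)) * (1 - A * q ^ (2 * j + n)) / qpoch q (A *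
        q ^ (2 * j)) (Suc n)"
  proof -
    have "qpoch q (- (a\<^sup>2) * q ^ j) (Suc n) = qpoch q (- (a\<^sup>2) * q ^ j) n * (1 + a\<^sup>2 * q ^ (j + n))"
      by (simp add: qpoch_Suc power_add mult_ac)
    moreover have "qpoch (q\<^sup>2) (A * q ^ (2 * j)) (Suc n) =
       qpoch (q\<^sup>2) (A * q ^ (2 * j)) n * (1 - A * q ^ (2 * (j + n)))"
      unfolding qpoch_Suc e ..
    moreover have "Suc (j + n) - j = Suc n" by simp
    ultimately show ?thesis
      unfolding U_def by simp
  qed
  also have "\<dots> = ?K * (qbinom q (j + n) j * (1 - q ^ Suc (j + n))) / qpoch q (A * q ^ (2 * j)) n *
    (qpoch q (A * q ^ (2 * j)) n / qpoch q (A * q ^ (2 * j)) (Suc n) * (1 - A * q ^ (2 * j + n)))"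
    unfolding b by simp
  also have "\<dots> = U (j + n) j * (1 - q ^ Suc (j + n)) * (1 + a\<^sup>2 * q ^ (j + n)) * (1 - A * q ^ (2 *
      (j + n)))"
    unfolding d by (simp add: U_def mult_ac)
  finally show ?thesis .
qed

lemma U_Suc_right:
  "U (j + n) (Suc j) * (1 - q ^ Suc j) * (1 + a\<^sup>2 * q ^ j) * (1 - A * q ^ (2 * j + n)) =
    - a * q ^ j * (1 - q ^ n) * (1 - A * q ^ (2 * j + 1)) * U (j + n) j"
proof (cases n)
  case 0
  then show ?thesis by (simp add: U_def qbinom_def)
next
  case (Suc n')
  have b: "qbinom q (j + n) (Suc j) * (1 - q ^ Suc j) = qbinom q (j + n) j * (1 - q ^ n)"
    by (simp add: qbinom_def qpoch_Suc field_simps power_add Suc)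
  have p: "qpoch q (- (a\<^sup>2) * q ^ j) n = (1 + a\<^sup>2 * q ^ j) * qpoch q (- (a\<^sup>2) * q ^ Suc j) n'"
    by (simp add: Suc qpoch_Suc_left mult_ac)
  have p2: "qpoch (q\<^sup>2) (A * q ^ (2 * j)) n = (1 - A * q ^ (2 * j)) * qpoch (q\<^sup>2) (A * q ^ (2 *
      Suc j)) n'"
    by (simp add: Suc qpoch_Suc_left mult_ac power2_eq_square)
  have p3: "qpoch q (A * q ^ (2 * j)) n * (1 - A * q ^ (2 * j + n)) =
     (1 - A * q ^ (2 * j)) * (1 - A * q ^ (2 * j + 1)) * qpoch q (A * q ^ (2 * Suc j)) n'"
  proof -
    have "qpoch q (A * q ^ (2 * j)) n * (1 - A * q ^ (2 * j + n)) = qpoch q (A * q ^ (2 * j)) (Suc n)"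
      by (simp add: qpoch_Suc power_add mult_ac)
    also have "\<dots> = (1 - A * q ^ (2 * j)) * (1 - A * q ^ (2 * j + 1)) * qpoch q (A * q ^ (2 * Suc j)) n'"
      by (simp add: Suc qpoch_Suc_left mult_ac)
    finally show ?thesis .
  qed
  have p4: "(1 - A * q ^ (2 * j)) * (1 - A * q ^ (2 * j + 1)) / qpoch q (A * q ^ (2 * j)) n
     = (1 - A * q ^ (2 * j + n)) / qpoch q (A * q ^ (2 * Suc j)) n'"
    using p3 by (simp add: divide_simps mult_ac del: power_Suc mult_Suc_right)
  let ?K = "- a * q ^ j * (- a) ^ j * q ^ (j choose 2) * qpoch q (- (a\<^sup>2) * q ^ Suc j) n' *
    qpoch (q\<^sup>2) (A * q ^ (2 * Suc j)) n' * (1 + a\<^sup>2 * q ^ j)"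
  have k: "j + n - Suc j = n'" "j + n - j = n" by (simp_all add: Suc)
  have "U (j + n) (Suc j) * (1 - q ^ Suc j) * (1 + a\<^sup>2 * q ^ j) * (1 - A * q ^ (2 * j + n)) =
     ?K * (qbinom q (j + n) (Suc j) * (1 - q ^ Suc j)) * ((1 - A * q ^ (2 * j + n)) / qpoch q (A *
         q ^ (2 * Suc j)) n')"
    unfolding U_def k by (simp add: choose_two_Suc power_add del: mult_Suc_right)
  also have "\<dots> = - a * q ^ j * (1 - q ^ n) * (1 - A * q ^ (2 * j + 1)) * U (j + n) j"
    unfolding b p4[symmetric] unfolding U_def k p p2 by (simp add: mult_ac del: mult_Suc_right)
  finally show ?thesis .
qed

text \<open>The factors (1 - q^(j+1))(1 + a^2 q^j) of \<open>\<gamma> j\<close> are those on the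
  left of \<open>U_Suc_right\<close>, so they are absorbed without a division by 1 + a^2
  q^j.\<close>

lemma \<gamma>_U:
  "\<gamma> j * U (j + n) (Suc j) * (1 - A * q ^ (2 * j + n)) =
    - a * q ^ j * (1 - q ^ n) * (1 + c\<^sup>2 * q ^ j) * \<gamma>_aux j * U (j + n) j"
proof -
  have nz: "1 - A * q ^ (2 * j + 1) \<noteq> 0"
    by (metis A_generic(1) eq_iff_diff_eq_0)
  have "\<gamma> j * U (j + n) (Suc j) * (1 - A * q ^ (2 * j + n)) =
    (1 + c\<^sup>2 * q ^ j) * \<gamma>_aux j / (1 - A * q ^ (2 * j + 1)) *
    (U (j + n) (Suc j) * (1 - q ^ Suc j) * (1 + a\<^sup>2 * q ^ j) * (1 - A * q ^ (2 * j + n)))"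
    by (simp add: \<gamma>_def)
  also have "\<dots> = - a * q ^ j * (1 - q ^ n) * (1 + c\<^sup>2 * q ^ j) * \<gamma>_aux j * U (j + n) j"
    unfolding U_Suc_right using nz by (simp add: field_simps)
  finally show ?thesis .
qed

text \<open>Comparison of the coefficients of P_0 when the expansion for \<open>k\<close> is
  multiplied by 1 + a^2 q^(2k) - a q^k X; \<open>U_rec_Suc\<close> treats the higher P_j.\<close>

lemma U_rec_0: "U (Suc k) 0 = (1 + a\<^sup>2 * q ^ (2 * k)) * U k 0 - a * q ^ k * (\<gamma> 0 * U k (Suc 0))"
proof -
  let ?z = "q ^ k"
  have nz: "1 - A * ?z \<noteq> 0" "1 - q * ?z \<noteq> 0" by simp_all
  have 1: "U (Suc k) 0 * (1 - q * ?z) * (1 - A * ?z) = U k 0 * (1 - q * ?z) * (1 + a\<^sup>2 * ?z) *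
      (1 - A * ?z\<^sup>2)"
    using U_Suc_left[of 0 k] by (simp add: power_even_eq)
  then have 1: "U (Suc k) 0 * (1 - A * ?z) = U k 0 * (1 + a\<^sup>2 * ?z) * (1 - A * ?z\<^sup>2)"
    using nz(2) by auto
  have 2: "\<gamma> 0 * U k (Suc 0) * (1 - A * ?z) = - a * (1 - ?z) * (1 + c\<^sup>2) * U k 0"
    using \<gamma>_U[of 0 k] by (simp add: \<gamma>_aux_def)
  have "((1 + a\<^sup>2 * ?z\<^sup>2) * U k 0 - a * ?z * (\<gamma> 0 * U k (Suc 0))) * (1 - A * ?z) =
    (1 + a\<^sup>2 * ?z\<^sup>2) * U k 0 * (1 - A * ?z) - a * ?z * (\<gamma> 0 * U k (Suc 0) * (1 - A * ?z))"
    by (simp add: algebra_simps)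
  also have "\<dots> = U (Suc k) 0 * (1 - A * ?z)"
    unfolding 1 2 by (simp add: A_def power2_eq_square algebra_simps)
  finally show ?thesis using nz(1) by (simp add: power_even_eq)
qed

lemma U_rec_Suc:
  assumes "j \<le> k"
  shows "U (Suc k) (Suc j) = (1 + a\<^sup>2 * q ^ (2 * k)) * U k (Suc j)
    - a * q ^ k * (U k j + \<gamma> (Suc j) * U k (Suc (Suc j)))"
proof (cases "j = k")
  case True
  then show ?thesis by (simp add: U_def qbinom_def choose_two_Suc power_add)
next
  case False
  then obtain n where k: "k = Suc j + n"
    using assms less_imp_Suc_add[of j k] by auto
  define y where "y = q ^ j"
  define z where "z = q ^ n"
  \<comment> \<open>The entry \<open>u\<close> is the reference: \<open>v\<close>, \<open>w\<close>
    and \<open>w2\<close> are multiples of it with denominators that genericity keeps nonzero. With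
    \<open>w\<close> as the reference one would divide by 1 + a^2 y, which may be zero.\<close>
  define u where "u = U k (Suc j)"
  define v where "v = U (Suc k) (Suc j)"
  define w where "w = U k j"
  define w2 where "w2 = \<gamma> (Suc j) * U k (Suc (Suc j))"
  have nz: "1 - A * q * y\<^sup>2 \<noteq> 0" "1 - A * q\<^sup>2 * y\<^sup>2 * z \<noteq> 0" "1 - q * z \<noteq> 0"
    using A_generic(1)[of "Suc (2 * j)"] A_generic(1)[of "2 + 2 * j + n"]
    by (simp_all add: y_def z_def power_add power_double power2_eq_square mult_ac)
  have 1: "v * (1 - q * z) * (1 - A * q\<^sup>2 * y\<^sup>2 * z) =
     u * (1 - q\<^sup>2 * y * z) * (1 + a\<^sup>2 * q * y * z) * (1 - A * (q * y * z)\<^sup>2)"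
    using U_Suc_left[of "Suc j" n]
    by (simp add: k v_def u_def y_def z_def power_add power_double power2_eq_square
        power_mult_distrib mult_ac)
  have 2: "w2 * (1 - A * q\<^sup>2 * y\<^sup>2 * z) * (1 - A * q * y\<^sup>2) =
      - a * q * y * (1 - z) * (1 + c\<^sup>2 * q * y) * (1 - A * y) * u"
    using \<gamma>_U[of "Suc j" n] nz(1)
    by (simp add: k w2_def u_def y_def z_def power_add power_double power2_eq_square
        power_mult_distrib \<gamma>_aux_def field_simps)
  have 3: "u * (1 - q * y) * (1 + a\<^sup>2 * y) * (1 - A * q * y\<^sup>2 * z) = - a * y * (1 - q * z) * (1 -
      A * q * y\<^sup>2) * w"
    using U_Suc_right[of j "Suc n"]
    by (simp add: k u_def w_def y_def z_def power_add power_double power2_eq_square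
        power_mult_distrib mult_ac)
  let ?D = "(1 - A * q * y\<^sup>2) * (1 - A * q\<^sup>2 * y\<^sup>2 * z) * (1 - q * z)"
  have "((1 + a\<^sup>2 * (q * y * z)\<^sup>2) * u - a * q * y * z * (w + w2)) * ?D =
    (1 + a\<^sup>2 * (q * y * z)\<^sup>2) * u * ?D
     + q * z * (1 - A * q\<^sup>2 * y\<^sup>2 * z) * (- a * y * (1 - q * z) * (1 - A * q * y\<^sup>2) * w)
     - a * q * y * z * (1 - q * z) * (w2 * (1 - A * q\<^sup>2 * y\<^sup>2 * z) * (1 - A * q * y\<^sup>2))"
    by (simp add: algebra_simps)
  also have "\<dots> = (1 - A * q * y\<^sup>2) * (v * (1 - q * z) * (1 - A * q\<^sup>2 * y\<^sup>2 * z))"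
    unfolding 1 2 3[symmetric] unfolding A_def by algebra
  also have "\<dots> = v * ?D" by (simp add: mult_ac)
  finally have "(1 + a\<^sup>2 * (q * y * z)\<^sup>2) * u - a * q * y * z * (w + w2) = v"
    using nz by simp
  then show ?thesis
    by (simp add: k u_def v_def w_def w2_def y_def z_def power_add
        power_double power2_eq_square mult_ac)
qed

text \<open>The factor new in degree k + 1 is (1 - a x q^k)(1 - a q^k / x) = 1 + a^2 q^(2k) - a q^k
  X, so the induction step only multiplies by X, which the three-term recurrence carries
  out.\<close>

lemma shifted_power_expansion:
  assumes "x \<noteq> 0"
  shows "qpoch q (a * x) k * qpoch q (a / x) k = (\<Sum>j\<le>k. U k j * monic_rec \<gamma> (x + 1 / x) j)"
proof (induction k)
  case (Suc k)
  let ?X = "x + 1 / x"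
  let ?P = "monic_rec \<gamma> ?X"
  have "qpoch q (a * x) (Suc k) * qpoch q (a / x) (Suc k) =
    (1 + a\<^sup>2 * q ^ (2 * k) - a * q ^ k * ?X) * (qpoch q (a * x) k * qpoch q (a / x) k)"
    unfolding power_even_eq using assms by (simp add: qpoch_Suc field_simps power2_eq_square)
  also have "\<dots> = (1 + a\<^sup>2 * q ^ (2 * k)) * (\<Sum>j\<le>k. U k j * ?P j) - a * q ^ k * (\<Sum>j\<le>k. U k j * (?X *
      ?P j))"
    unfolding Suc left_diff_distrib by (simp only: sum_distrib_left mult_ac)
  also have "(\<Sum>j\<le>k. U k j * (?X * ?P j)) = (\<Sum>j\<le>k. U k j * ?P (Suc j)) + (\<Sum>j\<le>Suc k. U k (Suc j) *
      \<gamma> j * ?P j)"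
    unfolding sum_times_monic_rec
    by (simp add: lessThan_Suc_atMost[symmetric] U_def qbinom_def)
  also have "(\<Sum>j\<le>k. U k j * ?P j) = (\<Sum>j\<le>Suc k. U k j * ?P j)"
    by (simp add: U_def qbinom_def)
  also have "(1 + a\<^sup>2 * q ^ (2 * k)) * (\<Sum>j\<le>Suc k. U k j * ?P j) -
     a * q ^ k * ((\<Sum>j\<le>k. U k j * ?P (Suc j)) + (\<Sum>j\<le>Suc k. U k (Suc j) * \<gamma> j * ?P j)) =
     ((1 + a\<^sup>2 * q ^ (2 * k)) * U k 0 - a * q ^ k * (\<gamma> 0 * U k (Suc 0))) * ?P 0 +
     (\<Sum>j\<le>k. ((1 + a\<^sup>2 * q ^ (2 * k)) * U k (Suc j)
        - a * q ^ k * (U k j + \<gamma> (Suc j) * U k (Suc (Suc j)))) * ?P (Suc j))"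
    unfolding sum.atMost_Suc_shift
    by (simp add: algebra_simps sum.distrib sum_subtractf sum_distrib_left)
  also have "\<dots> = U (Suc k) 0 * ?P 0 + (\<Sum>j\<le>k. U (Suc k) (Suc j) * ?P (Suc j))"
    unfolding U_rec_0[symmetric] by (simp add: U_rec_Suc[symmetric])
  also have "\<dots> = (\<Sum>j\<le>Suc k. U (Suc k) j * ?P j)"
    by (simp only: sum.atMost_Suc_shift)
  finally show ?case .
qed (simp add: U_def qbinom_def numeral_2_eq_2)

end

section \<open>Expansion in Rogers polynomials\<close>

context qbase begin

text \<open>The coefficients of the continuous q-ultraspherical polynomial C_n(.; \<beta> | q),
  divided by its leading coefficient (\<beta>; q)_n / (q; q)_n.\<close>

definition rogers_coeff :: "complex \<Rightarrow> nat \<Rightarrow> nat \<Rightarrow> complex" where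
  "rogers_coeff \<beta> n k = qbinom q n k * qpoch q \<beta> k * qpoch q \<beta> (n - k) / qpoch q \<beta> n"

definition rogers_rec :: "complex \<Rightarrow> nat \<Rightarrow> complex" where
  "rogers_rec \<beta> n = (1 - q ^ Suc n) * (1 - \<beta>\<^sup>2 * q ^ n) / ((1 - \<beta> * q ^ n) * (1 - \<beta> * q ^ Suc n))"

definition rogers :: "complex \<Rightarrow> nat \<Rightarrow> complex \<Rightarrow> complex" where
  "rogers \<beta> n x = (\<Sum>k\<le>n. rogers_coeff \<beta> n k * x powi (2 * int k - int n))"

text \<open>The three other coefficients are multiples \<open>f1\<close>, \<open>f2\<close>,
  \<open>f3\<close> of \<open>u = rogers_coeff \<beta> n k\<close>, rational in y = q^k and z =
  q^(n-k). The recurrence becomes the identity f3 = f1 + f2 -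
  \<open>rogers_rec \<beta> n\<close>.\<close>

lemma rogers_coeff_rec:
  assumes \<beta>: "\<And>n. \<beta> * q ^ n \<noteq> 1"
  shows "rogers_coeff \<beta> (Suc (Suc n)) (Suc k) =
    rogers_coeff \<beta> (Suc n) k + rogers_coeff \<beta> (Suc n) (Suc k) - rogers_rec \<beta> n * rogers_coeff \<beta> n k"
proof -
  have pnz: "qpoch q \<beta> j \<noteq> 0" for j
    using \<beta> by (simp add: qpoch_eq_0_iff mult.commute)
  show ?thesis
  proof (cases "k \<le> n")
    case False
    then show ?thesis by (cases "k = Suc n") (auto simp: rogers_coeff_def qbinom_def pnz)
  next
    case True
    then obtain i where n: "n = k + i" using le_Suc_ex by blast
    define u where "u = rogers_coeff \<beta> n k"
    define y where "y = q ^ k"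
    define z where "z = q ^ i"
    have nz: "1 - q * y \<noteq> 0" "1 - q * z \<noteq> 0" "1 - \<beta> * (y * z) \<noteq> 0" "1 - \<beta> * (q * y * z) \<noteq> 0"
      using \<beta>[of n] \<beta>[of "Suc n"] by (simp_all add: y_def z_def n power_add mult_ac)
    define f1 where "f1 = (1 - q * y * z) * (1 - \<beta> * z) / ((1 - q * z) * (1 - \<beta> * (y * z)))"
    define f2 where "f2 = (1 - q * y * z) * (1 - \<beta> * y) / ((1 - q * y) * (1 - \<beta> * (y * z)))"
    define f3 where "f3 = (1 - q * y * z) * (1 - q\<^sup>2 * y * z) * (1 - \<beta> * y) * (1 - \<beta> * z) /
      ((1 - q * y) * (1 - q * z) * (1 - \<beta> * (y * z)) * (1 - \<beta> * (q * y * z)))"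
    have "rogers_coeff \<beta> (Suc n) k = u * f1"
      using nz pnz by (simp add: f1_def rogers_coeff_def u_def y_def z_def n qbinom_def
          qpoch_Suc Suc_diff_le power_add field_simps)
    moreover have "rogers_coeff \<beta> (Suc n) (Suc k) = u * f2"
      using nz pnz by (simp add: f2_def rogers_coeff_def u_def y_def z_def n qbinom_def
          qpoch_Suc Suc_diff_le power_add field_simps)
    moreover have "rogers_coeff \<beta> (Suc (Suc n)) (Suc k) = u * f3"
      using nz pnz by (simp add: f3_def rogers_coeff_def u_def y_def z_def n qbinom_def
          qpoch_Suc Suc_diff_le power_add power2_eq_square field_simps)
    moreover have "rogers_rec \<beta> n = (1 - q * y * z) * (1 - \<beta>\<^sup>2 * y * z) / ((1 - \<beta> * (y * z)) *
        (1 - \<beta> * (q * y * z)))"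
      by (simp add: rogers_rec_def y_def z_def n power_add mult_ac)
    then have "f3 = f1 + f2 - rogers_rec \<beta> n"
      using nz by (simp add: f1_def f2_def f3_def divide_simps) algebra
    ultimately show ?thesis
      by (simp add: algebra_simps flip: u_def)
  qed
qed

lemma monic_rec_rogers:
  assumes \<beta>: "\<And>n. \<beta> * q ^ n \<noteq> 1" and x: "x \<noteq> 0"
  shows "monic_rec (rogers_rec \<beta>) (x + 1 / x) n = rogers \<beta> n x"
proof (induction "rogers_rec \<beta>" "x + 1 / x" n rule: monic_rec.induct)
  case 1
  then show ?case by (simp add: rogers_def rogers_coeff_def)
next
  case 2
  have "1 - \<beta> \<noteq> 0" using \<beta>[of 0] by simp
  then show ?case using q_power_neq_1[of 1]
    by (simp add: rogers_def rogers_coeff_def power_int_minus qbinom_def qpoch_Suc inverse_eq_divide)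
next
  case (3 n)
  let ?\<rho> = "rogers_coeff \<beta>"
  \<comment> \<open>The powers of x that occur in degree n + 2; the polynomials of degree n and n +
    1 are reindexed to them before coefficients are compared.\<close>
  define T where "T k = x powi (2 * int k - int (Suc (Suc n)))" for k
  have pnz: "qpoch q \<beta> j \<noteq> 0" for j
    using \<beta> by (simp add: qpoch_eq_0_iff mult.commute)
  have \<rho>0: "?\<rho> m 0 = 1" for m
    using pnz by (simp add: rogers_coeff_def)
  have T1: "x powi (2 * int k - int n) = T (Suc k)" for k
    by (simp add: T_def)
  have T2: "(x + 1 / x) * x powi (2 * int k - int (Suc n)) = T (Suc k) + T k" for k
  proof -
    have "T (Suc k) = x powi (2 * int k - int (Suc n)) * x"
      using x power_int_add[of x "2 * int k - int (Suc n)" 1] by (simp add: T_def algebra_simps)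
    moreover have "T k = x powi (2 * int k - int (Suc n)) / x"
      using x power_int_diff[of x "2 * int k - int (Suc n)" 1] by (simp add: T_def algebra_simps)
    ultimately show ?thesis by (simp add: algebra_simps)
  qed
  have "(x + 1 / x) * rogers \<beta> (Suc n) x = (\<Sum>k\<le>Suc n. ?\<rho> (Suc n) k * ((x + 1 / x) * x powi (2 *
      int k - int (Suc n))))"
    unfolding rogers_def by (simp only: sum_distrib_left mult_ac)
  also have "\<dots> = (\<Sum>k\<le>Suc n. ?\<rho> (Suc n) k * T (Suc k)) + (\<Sum>k\<le>Suc n. ?\<rho> (Suc n) k * T k)"
    unfolding T2 by (simp only: distrib_left sum.distrib)
  also have "(\<Sum>k\<le>Suc n. ?\<rho> (Suc n) k * T k) = (\<Sum>k\<le>Suc (Suc n). ?\<rho> (Suc n) k * T k)"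
    by (simp add: rogers_coeff_def qbinom_def)
  also have "\<dots> = T 0 + (\<Sum>k\<le>Suc n. ?\<rho> (Suc n) (Suc k) * T (Suc k))"
    by (simp only: sum.atMost_Suc_shift[of _ "Suc n"] \<rho>0 mult_1_left)
  finally have a: "(x + 1 / x) * rogers \<beta> (Suc n) x = (\<Sum>k\<le>Suc n. ?\<rho> (Suc n) k * T (Suc k))
     + (T 0 + (\<Sum>k\<le>Suc n. ?\<rho> (Suc n) (Suc k) * T (Suc k)))" .
  have b: "rogers \<beta> n x = (\<Sum>k\<le>Suc n. ?\<rho> n k * T (Suc k))"
    by (simp add: rogers_def rogers_coeff_def qbinom_def T1)
  have "rogers \<beta> (Suc (Suc n)) x = T 0 + (\<Sum>k\<le>Suc n. ?\<rho> (Suc (Suc n)) (Suc k) * T (Suc k))"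
    unfolding rogers_def sum.atMost_Suc_shift[of _ "Suc n"] \<rho>0 T_def by simp
  also have "\<dots> = (x + 1 / x) * rogers \<beta> (Suc n) x - rogers_rec \<beta> n * rogers \<beta> n x"
  proof -
    have "(\<Sum>k\<le>Suc n. ?\<rho> (Suc (Suc n)) (Suc k) * T (Suc k)) = (\<Sum>k\<le>Suc n. ?\<rho> (Suc n) k * T (Suc k))
      + (\<Sum>k\<le>Suc n. ?\<rho> (Suc n) (Suc k) * T (Suc k)) - rogers_rec \<beta> n * (\<Sum>k\<le>Suc n. ?\<rho> n k * T (Suc k))"
      unfolding rogers_coeff_rec[OF \<beta>]
      by (simp only: sum_distrib_left left_diff_distrib distrib_right sum.distrib sum_subtractf mult.assoc)
    then show ?thesis unfolding a b by (simp only: algebra_simps)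
  qed
  finally show ?case using 3 by simp
qed

end

section \<open>Connection coefficients from the Rogers polynomials to the P_N\<close>

context even_aw begin

lemma qbase_square: "qbase (q\<^sup>2)"
  using q_nonzero q_power_neq_1[of "2 * n" for n] by unfold_locales (simp_all flip: power_mult)

text \<open>The connection coefficient of the Rogers polynomial of degree \<open>M\<close> in \<open>P\<^sub>M\<^sub>+\<^sub>2\<^sub>l\<close>.\<close>
definition D :: "nat \<Rightarrow> nat \<Rightarrow> complex" where
  "D M l = q ^ l * qpoch (q\<^sup>2) (c\<^sup>2 / q) l * qpoch q (q ^ Suc M) (2 * l) * qpoch q (- (a\<^sup>2) *
      q ^ M) (2 * l)
    / (qpoch (q\<^sup>2) (q\<^sup>2) l * qpoch (q\<^sup>2) (a\<^sup>2 * q ^ (2 * M + 2)) l * qpoch (q\<^sup>2) (A * q ^ (2 * M +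
        2 * l) / q) l)"

abbreviation \<rho> :: "nat \<Rightarrow> complex" where
  "\<rho> \<equiv> qbase.rogers_rec (q\<^sup>2) (a\<^sup>2)"

lemma D_0 [simp]: "D M 0 = 1"
  by (simp add: D_def)

lemma D_denominators_nonzero: "qpoch (q\<^sup>2) (q\<^sup>2) l \<noteq> 0" "qpoch (q\<^sup>2) (a\<^sup>2 * q ^ m) l \<noteq> 0"
  "qpoch (q\<^sup>2) (A * q ^ (2 * M + 2 * l) / q) l \<noteq> 0"
proof -
  show "qpoch (q\<^sup>2) (q\<^sup>2) l \<noteq> 0"
    using qbase_square qbase.qpoch_q_nonzero by blast
  have "(q\<^sup>2) ^ i * (a\<^sup>2 * q ^ m) \<noteq> 1" for i
    using a_generic[of "2 * i + m"] by (simp add: power_add power_double power2_eq_square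
        power_mult_distrib mult_ac)
  then show "qpoch (q\<^sup>2) (a\<^sup>2 * q ^ m) l \<noteq> 0"
    by (simp add: qpoch_eq_0_iff)
  \<comment> \<open>An index i < l exists only if l is positive; then the division by q leaves a
    nonnegative exponent, to which genericity applies.\<close>
  have "(q\<^sup>2) ^ i * (A * q ^ (2 * M + 2 * l) / q) \<noteq> 1" if il: "i < l" for i
  proof -
    obtain l' where "l = Suc l'" using il by (cases l) auto
    then have "(q\<^sup>2) ^ i * (A * q ^ (2 * M + 2 * l) / q) = A * q ^ (2 * i + 2 * M + 2 * l' + 1)"
      using q_nonzero by (simp add: power_add power_double power2_eq_square power_mult_distrib mult_ac)
    then show ?thesis by (metis A_generic(1))
  qed
  then show "qpoch (q\<^sup>2) (A * q ^ (2 * M + 2 * l) / q) l \<noteq> 0"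
    by (auto simp: qpoch_eq_0_iff)
qed

text \<open>Coefficient of the Rogers polynomial R_M in P_(N+2) = X P_(N+1) - \<gamma>_N P_N for N =
  2l + M. The product X R_(M-1) gives the term with \<open>M - 1\<close>, absent for M = 0, and X
  R_(M+1) gives the one with \<open>\<rho> M\<close>.\<close>

lemma D_rec:
  "D M (Suc l) + \<gamma> (2 * l + M) * D M l = (if M = 0 then 0 else D (M - 1) (Suc l)) + D (Suc M) l * \<rho> M"
proof -
  \<comment> \<open>With this variable both A = a^2 e q and c^2 = e q are free of division by
    q.\<close>
  define e where "e = c\<^sup>2 / q"
  define u where "u = D M l"
  define y where "y = q ^ M"
  define z where "z = q ^ (2 * l)"
  have A: "A = a\<^sup>2 * e * q" and c2: "c\<^sup>2 = e * q" using q_nonzero by (simp_all add: A_def e_def)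
  have zz: "(q\<^sup>2) ^ l = z" by (simp add: z_def power_mult)
  have dbl: "qpoch p v (2 * Suc l) = qpoch p v (2 * l) * (1 - p ^ (2 * l) * v) * (1 - p ^ Suc (2 *
      l) * v)" for p v
    by (simp add: qpoch_Suc)
  define B where "B = a\<^sup>2 * e * y\<^sup>2 * z"
  have B: "A * q ^ (2 * M + 2 * l) / q = B"
    using q_nonzero by (simp add: A B_def y_def z_def power_add power_even_eq)
  define P1 where "P1 = q ^ l * qpoch (q\<^sup>2) e l"
  define P2 where "P2 = qpoch q (q * y) (2 * l)"
  define P3 where "P3 = qpoch q (- (a\<^sup>2) * y) (2 * l)"
  define P4 where "P4 = qpoch (q\<^sup>2) (q\<^sup>2) l"
  define P5 where "P5 = qpoch (q\<^sup>2) (a\<^sup>2 * q\<^sup>2 * y\<^sup>2) l"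
  define P6 where "P6 = qpoch (q\<^sup>2) B l"
  define P6' where "P6' = qpoch (q\<^sup>2) (q\<^sup>2 * B) l"
  define P6'' where "P6'' = qpoch (q\<^sup>2) (q\<^sup>2 * B) (Suc l)"
  have M2: "a\<^sup>2 * q ^ (2 * M + 2) = a\<^sup>2 * q\<^sup>2 * y\<^sup>2"
    by (simp add: y_def power_add power_even_eq power2_eq_square)
  have u: "u = P1 * P2 * P3 / (P4 * P5 * P6)"
    unfolding u_def D_def B M2 P1_def P2_def P3_def P4_def P5_def P6_def e_def[symmetric]
    by (simp add: y_def)
  have P: "P4 \<noteq> 0" "P5 \<noteq> 0" "P6 \<noteq> 0"
    using D_denominators_nonzero(1)[of l] D_denominators_nonzero(2)[of "2 * M +
        2" l] D_denominators_nonzero(3)[of M l]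
    unfolding P4_def P5_def P6_def M2 B by auto
  \<comment> \<open>The relations 1, 2 and 3 tie the other three values of \<open>D\<close> to
    \<open>u = D M l\<close>, cross-multiplied, with y = q^M and z = q^(2l).\<close>
  have 1: "D M (Suc l) * ((1 - q\<^sup>2 * z) * (1 - a\<^sup>2 * q\<^sup>2 * y\<^sup>2 * z) * (1 - a\<^sup>2 * e * y\<^sup>2 * z\<^sup>2) *
      (1 - a\<^sup>2 * e * q\<^sup>2 * y\<^sup>2 * z\<^sup>2)) =
    u * (q * (1 - e * z) * (1 - q * y * z) * (1 - q\<^sup>2 * y * z) * (1 + a\<^sup>2 * y * z) * (1 + a\<^sup>2 * q *
        y * z) * (1 - a\<^sup>2 * e * y\<^sup>2 * z))"
  proof -
    have B': "A * q ^ (2 * M + 2 * Suc l) / q = q\<^sup>2 * B"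
      unfolding B[symmetric] by (simp add: power2_eq_square)
    have e1: "q ^ Suc l * qpoch (q\<^sup>2) (c\<^sup>2 / q) (Suc l) = q * P1 * (1 - e * z)"
      unfolding P1_def e_def[symmetric] qpoch_Suc zz by (simp add: mult_ac)
    have e2: "qpoch q (q ^ Suc M) (2 * Suc l) = P2 * (1 - q * y * z) * (1 - q\<^sup>2 * y * z)"
      unfolding dbl P2_def z_def[symmetric] by (simp add: y_def z_def power2_eq_square mult_ac)
    have e3: "qpoch q (- (a\<^sup>2) * q ^ M) (2 * Suc l) = P3 * (1 + a\<^sup>2 * y * z) * (1 + a\<^sup>2 * q * y * z)"
      unfolding dbl P3_def z_def[symmetric] by (simp add: y_def z_def mult_ac)
    have e4: "qpoch (q\<^sup>2) (q\<^sup>2) (Suc l) = P4 * (1 - q\<^sup>2 * z)"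
      unfolding qpoch_Suc zz P4_def by (simp add: mult_ac)
    have e5: "qpoch (q\<^sup>2) (a\<^sup>2 * q ^ (2 * M + 2)) (Suc l) = P5 * (1 - a\<^sup>2 * q\<^sup>2 * y\<^sup>2 * z)"
      unfolding M2 qpoch_Suc zz P5_def by (simp add: mult_ac)
    have e6: "P6'' * (1 - B) = P6 * (1 - z * B) * (1 - q\<^sup>2 * z * B)"
    proof -
      have "P6'' * (1 - B) = qpoch (q\<^sup>2) B (Suc (Suc l))"
        by (simp add: P6''_def qpoch_Suc_left[of _ B] mult.commute)
      then show ?thesis
        unfolding qpoch_Suc power_Suc zz P6_def by (simp add: mult_ac)
    qed
    have nz: "1 - q\<^sup>2 * z \<noteq> 0" "1 - a\<^sup>2 * q\<^sup>2 * y\<^sup>2 * z \<noteq> 0" "P6'' \<noteq> 0"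
      using D_denominators_nonzero(1)[of "Suc l"] D_denominators_nonzero(2)[of "2 * M + 2"
          "Suc l"] D_denominators_nonzero(3)[of M "Suc l"]
      unfolding e4 e5 P6''_def B' by auto
    have f: "(1 - z * B) * (1 - q\<^sup>2 * z * B) / P6'' = (1 - B) / P6"
      using e6 nz P by (simp add: frac_eq_eq mult_ac)
    have "D M (Suc l) = q * P1 * (1 - e * z) * (P2 * (1 - q * y * z) * (1 - q\<^sup>2 * y * z)) * (P3 *
        (1 + a\<^sup>2 * y * z) * (1 + a\<^sup>2 * q * y * z))
       / (P4 * (1 - q\<^sup>2 * z) * (P5 * (1 - a\<^sup>2 * q\<^sup>2 * y\<^sup>2 * z)) * P6'')"
      unfolding D_def e1 e2 e3 e4 e5 B' P6''_def ..
    then have "D M (Suc l) * ((1 - q\<^sup>2 * z) * (1 - a\<^sup>2 * q\<^sup>2 * y\<^sup>2 * z) * ((1 - z * B) * (1 - q\<^sup>2 *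
        z * B))) =
      q * P1 * (1 - e * z) * (P2 * (1 - q * y * z) * (1 - q\<^sup>2 * y * z)) * (P3 * (1 + a\<^sup>2 * y * z) *
          (1 + a\<^sup>2 * q * y * z)) / (P4 * P5) *
       ((1 - z * B) * (1 - q\<^sup>2 * z * B) / P6'')"
      using nz by simp (simp only: mult_ac)
    then show ?thesis
      unfolding f u by (simp add: B_def power2_eq_square mult_ac)
  qed
  have 2: "D (Suc M) l * \<rho> M * ((1 - a\<^sup>2 * y\<^sup>2) * (1 - a\<^sup>2 * q\<^sup>2 * y\<^sup>2 * z) * (1 - a\<^sup>2 * e * y\<^sup>2 *
      z\<^sup>2)) =
    u * ((1 + q * y) * (1 - a\<^sup>2 * y) * (1 - q * y * z) * (1 + a\<^sup>2 * y * z) * (1 - a\<^sup>2 * e * y\<^sup>2 * z))"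
  proof -
    define P2' where "P2' = qpoch q (q\<^sup>2 * y) (2 * l)"
    define P3' where "P3' = qpoch q (- (a\<^sup>2) * q * y) (2 * l)"
    define P5' where "P5' = qpoch (q\<^sup>2) (a\<^sup>2 * q ^ 4 * y\<^sup>2) l"
    have B': "A * q ^ (2 * Suc M + 2 * l) / q = q\<^sup>2 * B"
      unfolding B[symmetric] by (simp add: power2_eq_square)
    have M4: "a\<^sup>2 * q ^ (2 * Suc M + 2) = a\<^sup>2 * q ^ 4 * y\<^sup>2"
      by (simp add: y_def power_add power_even_eq power2_eq_square numeral_eq_Suc)
    have e2: "P2' * (1 - q * y) = P2 * (1 - q * y * z)"
      using qpoch_Suc[of q "q * y" "2 * l"]
      by (simp add: P2'_def P2_def qpoch_Suc_left power2_eq_square z_def mult_ac)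
    have e3: "P3' * (1 + a\<^sup>2 * y) = P3 * (1 + a\<^sup>2 * y * z)"
      using qpoch_Suc[of q "- (a\<^sup>2) * y" "2 * l"]
      by (simp add: P3'_def P3_def qpoch_Suc_left z_def mult_ac)
    have e5: "P5' * (1 - a\<^sup>2 * q\<^sup>2 * y\<^sup>2) = P5 * (1 - a\<^sup>2 * q\<^sup>2 * y\<^sup>2 * z)"
    proof -
      have "q\<^sup>2 * (a\<^sup>2 * q\<^sup>2 * y\<^sup>2) = a\<^sup>2 * q ^ 4 * y\<^sup>2" by (simp add: power2_eq_square numeral_eq_Suc)
      then show ?thesis
        using qpoch_Suc[of "q\<^sup>2" "a\<^sup>2 * q\<^sup>2 * y\<^sup>2" l]
        unfolding qpoch_Suc_left by (simp add: P5'_def P5_def zz mult_ac)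
    qed
    have e6: "P6' * (1 - B) = P6 * (1 - z * B)"
      using qpoch_Suc[of "q\<^sup>2" B l]
      by (simp add: P6'_def P6_def qpoch_Suc_left zz mult_ac)
    have nz: "P5' \<noteq> 0" "P6' \<noteq> 0" "1 - a\<^sup>2 * y\<^sup>2 \<noteq> 0" "1 - a\<^sup>2 * q\<^sup>2 * y\<^sup>2 \<noteq> 0"
      using D_denominators_nonzero(2)[of "2 * Suc M + 2" l] D_denominators_nonzero(3)[of
          "Suc M" l] a_generic[of "2 * M"] a_generic[of "2 * M + 2"]
      unfolding M4 P5'_def P6'_def B' M2 by (auto simp: y_def power_even_eq)
    have f: "(1 - z * B) / P6' = (1 - B) / P6"
      using e6 nz P by (simp add: frac_eq_eq mult_ac)
    have g: "(1 - a\<^sup>2 * q\<^sup>2 * y\<^sup>2 * z) / ((1 - a\<^sup>2 * q\<^sup>2 * y\<^sup>2) * P5') = 1 / P5"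
    proof (subst frac_eq_eq)
      show "(1 - a\<^sup>2 * q\<^sup>2 * y\<^sup>2 * z) * P5 = 1 * ((1 - a\<^sup>2 * q\<^sup>2 * y\<^sup>2) * P5')"
        using e5 by (simp only: mult_1_left mult_ac)
    qed (use nz P in simp_all)
    have "D (Suc M) l = P1 * P2' * P3' / (P4 * P5' * P6')"
      unfolding D_def B' M4 P1_def P2'_def P3'_def P4_def P5'_def P6'_def e_def[symmetric]
      by (simp add: y_def power2_eq_square mult_ac)
    moreover have "\<rho> M = (1 - q * y) * (1 + q * y) * ((1 - a\<^sup>2 * y) * (1 + a\<^sup>2 * y)) / ((1 - a\<^sup>2 *
        y\<^sup>2) * (1 - a\<^sup>2 * q\<^sup>2 * y\<^sup>2))"
    proof -
      have "(q\<^sup>2) ^ M = y\<^sup>2" "(q\<^sup>2) ^ Suc M = q\<^sup>2 * y\<^sup>2"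
        by (simp_all add: y_def power_mult[symmetric] mult.commute)
      then show ?thesis
        unfolding qbase.rogers_rec_def[OF qbase_square] by (simp add: power2_eq_square algebra_simps)
    qed
    ultimately have "D (Suc M) l * \<rho> M * ((1 - a\<^sup>2 * y\<^sup>2) * (1 - a\<^sup>2 * q\<^sup>2 * y\<^sup>2 * z) * (1 - z * B)) =
      P1 * (P2' * (1 - q * y)) * (P3' * (1 + a\<^sup>2 * y)) * (1 + q * y) * (1 - a\<^sup>2 * y) / P4 *
      ((1 - z * B) / P6') * ((1 - a\<^sup>2 * q\<^sup>2 * y\<^sup>2 * z) / ((1 - a\<^sup>2 * q\<^sup>2 * y\<^sup>2) * P5'))"
      using nz by simp (simp only: mult_ac)
    then show ?thesis
      unfolding f g e2 e3 u by (simp add: B_def power2_eq_square mult_ac)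
  qed
  have 3: "(if M = 0 then 0 else D (M - 1) (Suc l)) * ((1 - a\<^sup>2 * y\<^sup>2) * (1 - q\<^sup>2 * z) * (1 - a\<^sup>2 *
      e * y\<^sup>2 * z\<^sup>2)) =
    u * ((1 - e * z) * (1 - y) * (1 - q * y * z) * (q + a\<^sup>2 * y) * (1 + a\<^sup>2 * y * z))"
  proof (cases M)
    case 0
    then show ?thesis by (simp add: y_def)
  next
    case (Suc M')
    define y' where "y' = q ^ M'"
    have y: "y = q * y'" by (simp add: y_def y'_def Suc)
    have B': "A * q ^ (2 * M' + 2 * Suc l) / q = B"
      unfolding B[symmetric] by (simp add: power2_eq_square Suc)
    have M2': "a\<^sup>2 * q ^ (2 * M' + 2) = a\<^sup>2 * y\<^sup>2"
      by (simp add: y y'_def power_add power_even_eq power2_eq_square)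
    have e1: "q ^ Suc l * qpoch (q\<^sup>2) (c\<^sup>2 / q) (Suc l) = q * P1 * (1 - e * z)"
      unfolding P1_def e_def[symmetric] qpoch_Suc zz by (simp add: mult_ac)
    have e2: "qpoch q (q ^ Suc M') (2 * Suc l) = (1 - y) * P2 * (1 - q * y * z)"
      unfolding P2_def mult_Suc_right add_2_eq_Suc qpoch_Suc[of _ _ "Suc _"] qpoch_Suc_left[of _ _
          "2 * l"] y_def Suc
      by (simp add: z_def mult_ac)
    have e3: "q * qpoch q (- (a\<^sup>2) * q ^ M') (2 * Suc l) = (q + a\<^sup>2 * y) * P3 * (1 + a\<^sup>2 * y * z)"
      unfolding P3_def mult_Suc_right add_2_eq_Suc qpoch_Suc[of _ _ "Suc _"] qpoch_Suc_left[of _ _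
          "2 * l"] y_def Suc
      by (simp add: z_def algebra_simps)
    have e4: "qpoch (q\<^sup>2) (q\<^sup>2) (Suc l) = P4 * (1 - q\<^sup>2 * z)"
      unfolding qpoch_Suc zz P4_def by (simp add: mult_ac)
    have e5: "qpoch (q\<^sup>2) (a\<^sup>2 * y\<^sup>2) (Suc l) = P5 * (1 - a\<^sup>2 * y\<^sup>2)"
      unfolding qpoch_Suc_left P5_def by (simp add: mult_ac)
    have e6: "qpoch (q\<^sup>2) B (Suc l) = P6 * (1 - z * B)"
      unfolding qpoch_Suc zz P6_def by (simp add: mult_ac)
    have nz: "1 - q\<^sup>2 * z \<noteq> 0" "1 - a\<^sup>2 * y\<^sup>2 \<noteq> 0" "1 - z * B \<noteq> 0"
      using D_denominators_nonzero(1)[of "Suc l"] D_denominators_nonzero(2)[of "2 * M' + 2"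
          "Suc l"] D_denominators_nonzero(3)[of M' "Suc l"]
      unfolding e4 M2' e5 B' e6 by auto
    have "D M' (Suc l) = P1 * (1 - e * z) * ((1 - y) * P2 * (1 - q * y * z)) * (q * qpoch q (-
        (a\<^sup>2) * q ^ M') (2 * Suc l))
       / (P4 * (1 - q\<^sup>2 * z) * (P5 * (1 - a\<^sup>2 * y\<^sup>2)) * (P6 * (1 - z * B)))"
      unfolding D_def e1 e2 e4 M2' e5 B' e6 by (simp add: mult_ac)
    then have "D M' (Suc l) * ((1 - a\<^sup>2 * y\<^sup>2) * (1 - q\<^sup>2 * z) * (1 - z * B)) =
       P1 * (1 - e * z) * ((1 - y) * P2 * (1 - q * y * z)) * ((q + a\<^sup>2 * y) * P3 * (1 + a\<^sup>2 * y *
           z)) / (P4 * P5 * P6)"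
      unfolding e3 using nz by simp (simp only: mult_ac)
    then show ?thesis
      unfolding u by (simp add: Suc B_def power2_eq_square mult_ac)
  qed
  show ?thesis
  \<comment> \<open>For l = M = 0 the common factor 1 - a^2 e y^2 z^2 is 1 - A/q, which may vanish,
    and \<open>\<gamma>_aux\<close> takes its separate value. This case is computed
    directly.\<close>
  proof (cases "l = 0 \<and> M = 0")
    case True
    have nz: "1 - q\<^sup>2 \<noteq> 0" "1 - a\<^sup>2 \<noteq> 0" "1 - a\<^sup>2 * q\<^sup>2 \<noteq> 0" "1 - a\<^sup>2 * e * q\<^sup>2 \<noteq> 0"
      using q_power_neq_1[of 2] a_generic[of 0] a_generic[of 2] A_generic(1)[of 1]
          by (simp_all add: A power2_eq_square mult_ac)
    have "D 0 (Suc 0) * ((1 - q\<^sup>2) * (1 - a\<^sup>2 * q\<^sup>2) * (1 - a\<^sup>2 * e * q\<^sup>2)) =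
        q * (1 - e) * (1 - q) * (1 - q\<^sup>2) * (1 + a\<^sup>2) * (1 + a\<^sup>2 * q)"
      using nz q_nonzero unfolding D_def A c2
      by (simp add: qpoch_Suc numeral_2_eq_2 mult_ac)
    moreover have "\<gamma> 0 * (1 - a\<^sup>2 * e * q\<^sup>2) = (1 - q) * (1 + a\<^sup>2) * (1 + e * q)"
      unfolding \<gamma>_def \<gamma>_aux_def A c2 using nz by (simp add: power2_eq_square mult_ac)
    moreover have "\<rho> 0 * (1 - a\<^sup>2 * q\<^sup>2) = (1 - q\<^sup>2) * (1 + a\<^sup>2)"
      using nz unfolding qbase.rogers_rec_def[OF qbase_square]
      by (simp add: divide_simps mult_ac) (simp add: algebra_simps power2_eq_square power4_eq_xxxx)
    ultimately have "(D 0 (Suc 0) + \<gamma> 0 - \<rho> 0) * ((1 - q\<^sup>2) * (1 - a\<^sup>2 * q\<^sup>2) * (1 - a\<^sup>2 * e *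
        q\<^sup>2)) = 0"
      by algebra
    then show ?thesis using nz True by simp
  next
    case False
    have nz: "1 - q\<^sup>2 * z \<noteq> 0" "1 - a\<^sup>2 * y\<^sup>2 \<noteq> 0" "1 - a\<^sup>2 * q\<^sup>2 * y\<^sup>2 * z \<noteq> 0" "1 - a\<^sup>2 * e *
        y\<^sup>2 * z\<^sup>2 \<noteq> 0"
      "1 - a\<^sup>2 * e * q\<^sup>2 * y\<^sup>2 * z\<^sup>2 \<noteq> 0"
    proof -
      have "q * q ^ (2 * M + 4 * l - 1) = q ^ (2 * (M + 2 * l))"
        using False by (cases "2 * M + 4 * l") simp_all
      also have "\<dots> = y\<^sup>2 * z\<^sup>2"
        by (simp only: y_def z_def power_even_eq power_add power_mult_distrib)
      finally have "a\<^sup>2 * e * y\<^sup>2 * z\<^sup>2 = A * q ^ (2 * M + 4 * l - 1)"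
        by (simp add: A mult.assoc)
      then show "1 - a\<^sup>2 * e * y\<^sup>2 * z\<^sup>2 \<noteq> 0" by simp
      show "1 - q\<^sup>2 * z \<noteq> 0"
        using q_power_neq_1[of "2 + 2 * l"] by (simp add: z_def power_add power2_eq_square mult.assoc)
      show "1 - a\<^sup>2 * y\<^sup>2 \<noteq> 0"
        using a_generic[of "2 * M"] by (simp add: y_def power_even_eq)
      show "1 - a\<^sup>2 * q\<^sup>2 * y\<^sup>2 * z \<noteq> 0"
        using a_generic[of "2 + 2 * M + 2 * l"] by (simp add: y_def z_def power_add
            power_double mult_ac power2_eq_square)
      show "1 - a\<^sup>2 * e * q\<^sup>2 * y\<^sup>2 * z\<^sup>2 \<noteq> 0"
        using A_generic(1)[of "Suc (2 * (M + 2 * l))"]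
        unfolding A y_def z_def power_even_eq power_Suc power_add power_mult_distrib
        by (simp add: power2_eq_square mult_ac)
    qed
    have 4: "\<gamma> (2 * l + M) * ((1 - a\<^sup>2 * e * q\<^sup>2 * y\<^sup>2 * z\<^sup>2) * (1 - a\<^sup>2 * e * y\<^sup>2 * z\<^sup>2)) =
      (1 - q * y * z) * (1 + a\<^sup>2 * y * z) * (1 + e * q * y * z) * (1 - a\<^sup>2 * e * y * z)"
    proof -
      obtain n where n: "2 * l + M = Suc n" using False by (cases "2 * l + M") auto
      have yz: "q * q ^ n = y * z"
      proof -
        have "q * q ^ n = q ^ (2 * l + M)" unfolding n by simp
        then show ?thesis by (simp add: y_def z_def power_add mult.commute)
      qed
      have "A * q ^ n = a\<^sup>2 * e * (q * q ^ n)" "A * q ^ (2 * n + 1) = a\<^sup>2 * e * (q * q ^ n)\<^sup>2"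
        "A * q ^ (2 * Suc n + 1) = a\<^sup>2 * e * q\<^sup>2 * (q * q ^ n)\<^sup>2"
        by (simp_all add: A power_double power2_eq_square mult_ac)
      then have "\<gamma> (Suc n) = (1 - q * y * z) * (1 + a\<^sup>2 * y * z) * (1 + e * q * y * z) * ((1 - a\<^sup>2 *
          e * y * z) / (1 - a\<^sup>2 * e * y\<^sup>2 * z\<^sup>2)) / (1 - a\<^sup>2 * e * q\<^sup>2 * y\<^sup>2 * z\<^sup>2)"
        unfolding \<gamma>_def \<gamma>_aux_def yz c2 by (simp add: yz
            power_mult_distrib mult.assoc del: mult_Suc_right)
      then show ?thesis unfolding n using nz by simp
    qed
    let ?v = "D M (Suc l)" and ?w = "\<gamma> (2 * l + M)" and ?s = "if M = 0 then 0 else D (M - 1) (Suc l)"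
      and ?t = "D (Suc M) l * \<rho> M"
    let ?a = "1 - q\<^sup>2 * z" and ?b = "1 - a\<^sup>2 * y\<^sup>2" and ?c = "1 - a\<^sup>2 * q\<^sup>2 * y\<^sup>2 * z" and ?d =
        "1 - a\<^sup>2 * e * y\<^sup>2 * z\<^sup>2"
      and ?e = "1 - a\<^sup>2 * e * q\<^sup>2 * y\<^sup>2 * z\<^sup>2"
    \<comment> \<open>After multiplication by all five denominator factors each term matches one of
      the relations 1 to 4, and a polynomial identity remains.\<close>
    have "(v + w * u - s - t) * (a * b * c * d * e) = (v * (a * c * d * e)) * b + u * (w * (e *
        d)) * (a * b * c)
      - (s * (b * a * d)) * (c * e) - (t * (b * c * d)) * (a * e)" for v w u s t a b c d e :: complex
      by (simp add: algebra_simps)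
    then have "(?v + ?w * u - ?s - ?t) * (?a * ?b * ?c * ?d * ?e) =
      (?v * (?a * ?c * ?d * ?e)) * ?b + u * (?w * (?e * ?d)) * (?a * ?b * ?c) - (?s * (?b * ?a *
          ?d)) * (?c * ?e) - (?t * (?b * ?c * ?d)) * (?a * ?e)"
      .
    also have "\<dots> = 0"
      unfolding 1 2 3 4 by algebra
    finally have "?v + ?w * u - ?s - ?t = 0"
      by (simp only: mult_eq_0_iff nz simp_thms)
    moreover have "v + w - s - t = 0 \<Longrightarrow> v + w = s + t" for v w s t :: complex
      by (simp add: algebra_simps)
    ultimately show ?thesis
      unfolding u_def by blast
  qed
qed

text \<open>By \<open>D_rec\<close> the right side obeys the recurrence that defines the left side,
  and both agree in degrees 0 and 1.\<close>

lemma monic_rec_even: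
  assumes "x \<noteq> 0"
  shows "monic_rec \<gamma> (x + 1 / x) N =
    (\<Sum>l | 2 * l \<le> N. D (N - 2 * l) l * monic_rec \<rho> (x + 1 / x) (N - 2 * l))"
proof -
  let ?X = "x + 1 / x"
  let ?R = "monic_rec \<rho> ?X"
  \<comment> \<open>\<open>F\<close> extends \<open>D\<close> by zero, so that all sums can run over
    l up to the degree whatever its parity. \<open>H\<close> collects the lower terms that arise
    when X multiplies a Rogers polynomial.\<close>
  define F where "F N l = (if 2 * l \<le> N then D (N - 2 * l) l else 0)" for N l
  define S where "S N = (\<Sum>l\<le>N. F N l * ?R (N - 2 * l))" for N
  define H where "H N l = (if 2 * l \<le> N then F (Suc N) l * \<rho> (N - 2 * l) else 0)" for N l
  have "monic_rec \<gamma> ?X N = S N"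
  proof (induction \<gamma> ?X N rule: monic_rec.induct)
    case 1
    then show ?case by (simp add: S_def F_def)
  next
    case 2
    then show ?case by (simp add: S_def F_def)
  next
    case (3 N)
    have XR: "F (Suc N) l * (?X * ?R (Suc N - 2 * l)) =
       F (Suc N) l * ?R (Suc (Suc N) - 2 * l) + H N l * ?R (N - 2 * l)" for l
    proof -
      \<comment> \<open>In the middle case X R_0 = R_1 has no lower term, in agreement with H = 0;
        in the last case both sides vanish.\<close>
      consider "2 * l \<le> N" | "2 * l = Suc N" | "Suc N < 2 * l" by linarith
      then show ?thesis
        by cases (auto simp: F_def H_def Suc_diff_le algebra_simps)
    qed
    have DD: "F (Suc (Suc N)) (Suc l) * ?R (N - 2 * l) =
      F (Suc N) (Suc l) * ?R (N - 2 * l) + H N l * ?R (N - 2 * l) - \<gamma> N * (F N l * ?R (N - 2 *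
          l))" for l
    proof (cases "2 * l \<le> N")
      case True
      then obtain M where N: "N = 2 * l + M" using le_Suc_ex by blast
      have "F (Suc (Suc N)) (Suc l) = D M (Suc l)" "F N l = D M l" "H N l = D (Suc M) l * \<rho> M"
        by (simp_all add: N F_def H_def)
      moreover have "F (Suc N) (Suc l) = (if M = 0 then 0 else D (M - 1) (Suc l))"
        by (auto simp: N F_def)
      ultimately have "F (Suc (Suc N)) (Suc l) + \<gamma> N * F N l = F (Suc N) (Suc l) + H N l"
        using D_rec[of M l] by (simp only: N)
      then have "F (Suc (Suc N)) (Suc l) = F (Suc N) (Suc l) + H N l - \<gamma> N * F N l"
        by (simp add: algebra_simps)
      then show ?thesis by (simp only: left_diff_distrib distrib_right mult.assoc)
    qed (simp add: F_def H_def)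
    have F0: "F m 0 = 1" for m by (simp add: F_def)
    have "?X * S (Suc N) = (\<Sum>l\<le>Suc N. F (Suc N) l * (?X * ?R (Suc N - 2 * l)))"
      unfolding S_def by (simp only: sum_distrib_left mult_ac)
    also have "\<dots> = (\<Sum>l\<le>Suc N. F (Suc N) l * ?R (Suc (Suc N) - 2 * l)) + (\<Sum>l\<le>N. H N l * ?R (N - 2 * l))"
      unfolding XR sum.distrib by (simp add: H_def)
    also have "(\<Sum>l\<le>Suc N. F (Suc N) l * ?R (Suc (Suc N) - 2 * l)) =
       ?R (Suc (Suc N)) + (\<Sum>l\<le>N. F (Suc N) (Suc l) * ?R (N - 2 * l))"
      unfolding sum.atMost_Suc_shift by (simp add: F0)
    finally have a: "?X * S (Suc N) = ?R (Suc (Suc N)) + (\<Sum>l\<le>N. F (Suc N) (Suc l) * ?R (N - 2 * l))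
      + (\<Sum>l\<le>N. H N l * ?R (N - 2 * l))" .
    have "S (Suc (Suc N)) = (\<Sum>l\<le>Suc N. F (Suc (Suc N)) l * ?R (Suc (Suc N) - 2 * l))"
      unfolding S_def by (simp add: F_def)
    also have "\<dots> = ?R (Suc (Suc N)) + (\<Sum>l\<le>N. F (Suc (Suc N)) (Suc l) * ?R (N - 2 * l))"
      unfolding sum.atMost_Suc_shift by (simp add: F0)
    also have "\<dots> = ?X * S (Suc N) - \<gamma> N * S N"
      unfolding a DD by (simp add: sum.distrib sum_subtractf S_def sum_distrib_left)
    finally show ?case using 3 by simp
  qed
  also have "S N = (\<Sum>l | 2 * l \<le> N. D (N - 2 * l) l * ?R (N - 2 * l))"
    unfolding S_def by (rule sum.mono_neutral_cong_right) (auto simp: F_def)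
  finally show ?thesis .
qed

end

section \<open>The coefficients of the fourfold sum\<close>

lemma choose_two_add: "(m + n) choose 2 = (m choose 2) + (n choose 2) + m * n"
  by (induction n) (simp_all add: choose_two_Suc numeral_2_eq_2)

lemma power_choose_two_square: "(q ^ (n choose 2))\<^sup>2 * q ^ n = (q ^ n) ^ n" for q :: "'a::comm_ring_1"
proof -
  have "(n choose 2) * 2 + n = n * n"
    by (induction n) (simp_all add: choose_two_Suc numeral_2_eq_2)
  then show ?thesis by (metis power_mult power_add)
qed

text \<open>Reversing numerator and denominator together cancels the sign and the power of q with
  exponent n choose 2.\<close>

lemma qpoch_reverse_divide:
  assumes "w * v * q ^ n = q" "w' * v' * q ^ n = q" "q \<noteq> 0"
  shows "qpoch q w n / qpoch q w' n = (w / w') ^ n * (qpoch q v n / qpoch q v' n)"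
  using assms qpoch_reverse[OF assms(1,3)] qpoch_reverse[OF assms(2,3)]
  by (simp add: power_minus[of w] power_minus[of w'] power_divide)

lemma qpoch_double: "qpoch q a (2 * n) = qpoch (q\<^sup>2) a n * qpoch (q\<^sup>2) (q * a) n"
  by (induction n) (simp_all add: qpoch_Suc power_double power2_eq_square power_mult_distrib mult_ac)

section \<open>The factor \<open>c_e\<close> as connection coefficient times Rogers
  coefficient\<close>

context even_aw begin

text \<open>Here s = q^(-M-2l). Reversal of the products containing s replaces its negative powers
  of q by nonnegative ones; then the part that depends on k is a Rogers coefficient in base q^2 and
  the rest is \<open>D M l\<close>.\<close>

lemma c_e_eq:
  assumes s: "s * q ^ (M + 2 * l) = 1" and k: "k \<le> M"
  shows "c_e a c q k l s = D M l * qbase.rogers_coeff (q\<^sup>2) (a\<^sup>2) M k"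
proof -
  let ?Q = "q\<^sup>2"
  note nz = q_nonzero a_nonzero c_nonzero
  obtain i where M: "M = k + i" using k le_Suc_ex by blast
  have Qnz: "?Q \<noteq> 0" and snz: "s \<noteq> 0" using nz s by auto
  have sq: "s = 1 / (q ^ k * q ^ i * q ^ l * q ^ l)"
    using s nz by (simp add: M power_add power_double field_simps)
  have q4: "q ^ (4 * l) = q ^ l * q ^ l * q ^ l * q ^ l"
    by (simp add: power_mult power4_eq_xxxx power_mult_distrib)
  have Qp: "?Q ^ n = q ^ n * q ^ n" for n
    by (simp add: power2_eq_square power_mult_distrib)
  note simps = M q4 Qp power_add power_double power2_eq_square power3_eq_cube power4_eq_xxxx A_def
      power_mult_distrib
  have k1: "qpoch ?Q (q ^ (4 * l) * s\<^sup>2) k / qpoch ?Q (q ^ (4 * l + 2) * s\<^sup>2 / a\<^sup>2) k =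
     ((q ^ (4 * l) * s\<^sup>2) / (q ^ (4 * l + 2) * s\<^sup>2 / a\<^sup>2)) ^ k * (qpoch ?Q (?Q ^ Suc i) k /
         qpoch ?Q (a\<^sup>2 * ?Q ^ i) k)"
  proof (rule qpoch_reverse_divide)
    show "q ^ (4 * l) * s\<^sup>2 * ?Q ^ Suc i * ?Q ^ k = ?Q"
      unfolding sq using nz by (simp add: simps)
    show "q ^ (4 * l + 2) * s\<^sup>2 / a\<^sup>2 * (a\<^sup>2 * ?Q ^ i) * ?Q ^ k = ?Q"
      unfolding sq using nz by (simp add: simps)
  qed (rule Qnz)
  have l1: "qpoch ?Q (s\<^sup>2 / a\<^sup>2) l / qpoch ?Q (q ^ 3 * s\<^sup>2 / (a\<^sup>2 * c\<^sup>2)) l =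
    ((s\<^sup>2 / a\<^sup>2) / (q ^ 3 * s\<^sup>2 / (a\<^sup>2 * c\<^sup>2))) ^ l *
    (qpoch ?Q (a\<^sup>2 * ?Q ^ Suc (M + l)) l / qpoch ?Q (A * q ^ (2 * M + 2 * l) / q) l)"
  proof (rule qpoch_reverse_divide)
    show "s\<^sup>2 / a\<^sup>2 * (a\<^sup>2 * ?Q ^ Suc (M + l)) * ?Q ^ l = ?Q"
      unfolding sq using nz by (simp add: simps)
    show "q ^ 3 * s\<^sup>2 / (a\<^sup>2 * c\<^sup>2) * (A * q ^ (2 * M + 2 * l) / q) * ?Q ^ l = ?Q"
      unfolding sq using nz by (simp add: simps)
  qed (rule Qnz)
  have l2: "qpoch q s (2 * l) / qpoch q (q * s / a\<^sup>2) (2 * l) =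
    (s / (q * s / a\<^sup>2)) ^ (2 * l) * (qpoch q (q ^ Suc M) (2 * l) / qpoch q (a\<^sup>2 * q ^ M) (2 * l))"
  proof (rule qpoch_reverse_divide)
    show "s * q ^ Suc M * q ^ (2 * l) = q"
      using s by (simp add: power_add mult_ac)
    show "q * s / a\<^sup>2 * (a\<^sup>2 * q ^ M) * q ^ (2 * l) = q"
      using s nz by (simp add: power_add mult_ac)
  qed (rule q_nonzero)
  have l3: "qpoch ?Q (?Q * s\<^sup>2 / a ^ 4) (2 * l) / qpoch ?Q (s\<^sup>2 / a\<^sup>2) (2 * l) =
    ((?Q * s\<^sup>2 / a ^ 4) / (s\<^sup>2 / a\<^sup>2)) ^ (2 * l) * (qpoch ?Q (a ^ 4 * ?Q ^ M) (2 * l) /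
        qpoch ?Q (a\<^sup>2 * ?Q ^ Suc M) (2 * l))"
  proof (rule qpoch_reverse_divide)
    show "?Q * s\<^sup>2 / a ^ 4 * (a ^ 4 * ?Q ^ M) * ?Q ^ (2 * l) = ?Q"
      unfolding sq using nz by (simp add: simps)
    show "s\<^sup>2 / a\<^sup>2 * (a\<^sup>2 * ?Q ^ Suc M) * ?Q ^ (2 * l) = ?Q"
      unfolding sq using nz by (simp add: simps)
  qed (rule Qnz)
  \<comment> \<open>The factorizations \<open>p1\<close> and \<open>p2\<close> cancel the
    denominator of \<open>l2\<close> and the numerator of \<open>l1\<close>, respectively.\<close>
  have p1: "qpoch ?Q (a ^ 4 * ?Q ^ M) (2 * l) = qpoch q (a\<^sup>2 * q ^ M) (2 * l) * qpoch q (- (a\<^sup>2) *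
      q ^ M) (2 * l)"
  proof -
    have "(a\<^sup>2 * q ^ M)\<^sup>2 = a ^ 4 * ?Q ^ M"
      by (simp add: power_mult_distrib power2_eq_square power4_eq_xxxx)
    then show ?thesis using qpoch_mult_minus[of q "a\<^sup>2 * q ^ M" "2 * l"] by simp
  qed
  have p2: "qpoch ?Q (a\<^sup>2 * ?Q ^ Suc M) (2 * l) = qpoch ?Q (a\<^sup>2 * q ^ (2 * M + 2)) l *
      qpoch ?Q (a\<^sup>2 * ?Q ^ Suc (M + l)) l"
  proof -
    have "a\<^sup>2 * ?Q ^ Suc M = a\<^sup>2 * q ^ (2 * M + 2)" "?Q ^ l * (a\<^sup>2 * ?Q ^ Suc M) = a\<^sup>2 *
        ?Q ^ Suc (M + l)"
      by (simp_all add: power_add power_mult power_even_eq mult_ac power2_eq_square power_mult_distrib)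
    then show ?thesis using qpoch_add[of ?Q "a\<^sup>2 * ?Q ^ Suc M" l l] by (simp only: mult_2[of l])
  qed
  have n1: "qpoch ?Q (a\<^sup>2 * ?Q ^ m) n \<noteq> 0" for m n
    using D_denominators_nonzero(2)[of "2 * m" n] by (simp add: power_mult)
  have n2: "qpoch q (a\<^sup>2 * q ^ M) (2 * l) \<noteq> 0"
  proof -
    have "q ^ i * (a\<^sup>2 * q ^ M) \<noteq> 1" for i
      using a_generic[of "i + M"] by (simp add: power_add mult_ac)
    then show ?thesis by (simp add: qpoch_eq_0_iff)
  qed
  have n3: "qpoch ?Q (a\<^sup>2) n \<noteq> 0" for n
    using n1[of 0] by simp
  have "c_e a c q k l s = qpoch ?Q (a\<^sup>2) k / qpoch ?Q ?Q k * (?Q / a\<^sup>2) ^ k *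
      (qpoch ?Q (q ^ (4 * l) * s\<^sup>2) k / qpoch ?Q (q ^ (4 * l + 2) * s\<^sup>2 / a\<^sup>2) k) *
      (qpoch ?Q (c\<^sup>2 / q) l / qpoch ?Q ?Q l) * (?Q / c\<^sup>2) ^ l *
      (qpoch ?Q (s\<^sup>2 / a\<^sup>2) l / qpoch ?Q (q ^ 3 * s\<^sup>2 / (a\<^sup>2 * c\<^sup>2)) l) *
      (qpoch q s (2 * l) / qpoch q (q * s / a\<^sup>2) (2 * l)) *
      (qpoch ?Q (?Q * s\<^sup>2 / a ^ 4) (2 * l) / qpoch ?Q (s\<^sup>2 / a\<^sup>2) (2 * l))"
    unfolding c_e_def
        by (simp only: times_divide_eq_left times_divide_eq_right divide_divide_eq_left mult_ac)
  also have "\<dots> = (qpoch ?Q (a\<^sup>2) k / qpoch ?Q ?Q k * (qpoch ?Q (?Q ^ Suc i) k / qpoch ?Q (a\<^sup>2 *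
      ?Q ^ i) k)) *
      ((qpoch ?Q (c\<^sup>2 / q) l / qpoch ?Q ?Q l) *
      (qpoch ?Q (a\<^sup>2 * ?Q ^ Suc (M + l)) l / qpoch ?Q (A * q ^ (2 * M + 2 * l) / q) l) *
      (qpoch q (q ^ Suc M) (2 * l) / qpoch q (a\<^sup>2 * q ^ M) (2 * l)) *
      (qpoch ?Q (a ^ 4 * ?Q ^ M) (2 * l) / qpoch ?Q (a\<^sup>2 * ?Q ^ Suc M) (2 * l))) *
     ((?Q / a\<^sup>2) ^ k * ((q ^ (4 * l) * s\<^sup>2) / (q ^ (4 * l + 2) * s\<^sup>2 / a\<^sup>2)) ^ k) *
     ((?Q / c\<^sup>2) ^ l * ((s\<^sup>2 / a\<^sup>2) / (q ^ 3 * s\<^sup>2 / (a\<^sup>2 * c\<^sup>2))) ^ l * (s / (q * s / a\<^sup>2)) ^ (2 *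
         l) * ((?Q * s\<^sup>2 / a ^ 4) / (s\<^sup>2 / a\<^sup>2)) ^ (2 * l))"
    unfolding k1 l1 l2 l3 by (simp only: mult_ac)
  \<comment> \<open>The powers produced by the reversals combine with the explicit ones of
    \<open>c_e\<close>: to 1 for exponent k, to q^l for exponent l.\<close>
  also have "(?Q / a\<^sup>2) ^ k * ((q ^ (4 * l) * s\<^sup>2) / (q ^ (4 * l + 2) * s\<^sup>2 / a\<^sup>2)) ^ k = 1"
  proof -
    have "(?Q / a\<^sup>2) * ((q ^ (4 * l) * s\<^sup>2) / (q ^ (4 * l + 2) * s\<^sup>2 / a\<^sup>2)) = 1"
      using nz snz by (simp add: power_add power2_eq_square)
    then show ?thesis by (simp only: power_one flip: power_mult_distrib)
  qed
  also have "(?Q / c\<^sup>2) ^ l * ((s\<^sup>2 / a\<^sup>2) / (q ^ 3 * s\<^sup>2 / (a\<^sup>2 * c\<^sup>2))) ^ l * (s / (q * s /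
      a\<^sup>2)) ^ (2 * l) * ((?Q * s\<^sup>2 / a ^ 4) / (s\<^sup>2 / a\<^sup>2)) ^ (2 * l) = q ^ l"
  proof -
    have "(?Q / c\<^sup>2) * ((s\<^sup>2 / a\<^sup>2) / (q ^ 3 * s\<^sup>2 / (a\<^sup>2 * c\<^sup>2))) * (s / (q * s / a\<^sup>2))\<^sup>2 * ((?Q *
        s\<^sup>2 / a ^ 4) / (s\<^sup>2 / a\<^sup>2))\<^sup>2 = q"
      using nz snz by (simp add: field_simps eval_nat_numeral)
    then show ?thesis unfolding power_mult power_mult_distrib[symmetric] by (simp only:)
  qed
  also have "qpoch ?Q (a\<^sup>2) k / qpoch ?Q ?Q k * (qpoch ?Q (?Q ^ Suc i) k / qpoch ?Q (a\<^sup>2 * ?Q ^ i) k) =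
     qbase.rogers_coeff ?Q (a\<^sup>2) M k"
  proof -
    have "qpoch ?Q (a\<^sup>2) M = qpoch ?Q (a\<^sup>2) i * qpoch ?Q (a\<^sup>2 * ?Q ^ i) k"
      using qpoch_add[of ?Q "a\<^sup>2" i k] by (simp add: M add.commute mult.commute)
    moreover have "qpoch ?Q ?Q M = qpoch ?Q ?Q i * qpoch ?Q (?Q ^ Suc i) k"
      using qpoch_add[of ?Q ?Q i k] by (simp add: M add.commute mult.commute)
    moreover have "M - k = i" by (simp add: M)
    ultimately show ?thesis
      using n1 n3 D_denominators_nonzero(1) unfolding qbase.rogers_coeff_def[OF qbase_square] qbinom_def
      by (simp add: k)
  qed
  also have "(qpoch ?Q (c\<^sup>2 / q) l / qpoch ?Q ?Q l) *
      (qpoch ?Q (a\<^sup>2 * ?Q ^ Suc (M + l)) l / qpoch ?Q (A * q ^ (2 * M + 2 * l) / q) l) *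
      (qpoch q (q ^ Suc M) (2 * l) / qpoch q (a\<^sup>2 * q ^ M) (2 * l)) *
      (qpoch ?Q (a ^ 4 * ?Q ^ M) (2 * l) / qpoch ?Q (a\<^sup>2 * ?Q ^ Suc M) (2 * l)) = D M l / q ^ l"
    unfolding p1 p2 D_def using n1[of "Suc (M + l)" l] n2 nz
    by simp
  finally show ?thesis using nz by (simp add: mult_ac)
qed

section \<open>The factor \<open>c_o\<close> as a term of a transformed series\<close>

lemma qpoch_minus_ac_nonzero: "qpoch q (- (a * c * q ^ m)) n \<noteq> 0"
proof
  assume "qpoch q (- (a * c * q ^ m)) n = 0"
  then obtain i where "q ^ i * - (a * c * q ^ m) = 1" by (auto simp: qpoch_eq_0_iff)
  then have "(q ^ i * - (a * c * q ^ m))\<^sup>2 = 1" by simp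
  then have "A * q ^ (2 * (i + m)) = 1"
    by (simp add: A_def power_add power_double power2_eq_square mult_ac)
  then show False by simp
qed

text \<open>(A q^(2j); q)_(2n) is split in two ways, into halves and by the parity of the exponent.
  Its even part is (ac q^j, -ac q^j; q)_n.\<close>

lemma qpoch_A_double:
  "qpoch q (A * q ^ (2 * j + n)) n / qpoch (q\<^sup>2) (A * q ^ (2 * j + 1)) n =
   qpoch q (a * c * q ^ j) n * qpoch q (- (a * c * q ^ j)) n / qpoch q (A * q ^ (2 * j)) n"
proof -
  have "qpoch (q\<^sup>2) (A * q ^ (2 * j + 1)) n \<noteq> 0"
  proof -
    have "(q\<^sup>2) ^ i * (A * q ^ (2 * j + 1)) = A * q ^ (2 * i + (2 * j + 1))" for i
      by (simp add: power_add power_double power2_eq_square power_mult_distrib mult_ac)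
    then show ?thesis by (simp only: qpoch_eq_0_iff A_generic) simp
  qed
  moreover have "qpoch q (A * q ^ (2 * j)) n * qpoch q (A * q ^ (2 * j + n)) n =
    qpoch q (A * q ^ (2 * j)) (2 * n)"
    unfolding mult_2[of n] qpoch_add by (simp add: power_add mult_ac)
  moreover have "\<dots> = qpoch (q\<^sup>2) (A * q ^ (2 * j)) n * qpoch (q\<^sup>2) (A * q ^ (2 * j + 1)) n"
    unfolding qpoch_double by (simp add: mult_ac)
  moreover have "qpoch (q\<^sup>2) (A * q ^ (2 * j)) n = qpoch q (a * c * q ^ j) n * qpoch q (- (a * c *
      q ^ j)) n"
    unfolding qpoch_mult_minus by (simp add: A_def power_mult_distrib power_even_eq)
  ultimately show ?thesis
    by (simp add: frac_eq_eq mult_ac)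
qed

text \<open>The last bracket is the m-th term on the right of Sears' transformation of length m + n;
  the factors before it depend on m and n only through m + n. The product in front of
  \<open>c_o\<close> clears the denominators in abcd.\<close>

lemma c_o_eq:
  assumes b: "b \<noteq> 0" and d: "d \<noteq> 0" and abcd: "\<And>n. a * b * c * d * q ^ n \<noteq> 1"
    and s: "s * q ^ (j + m + n) = 1"
  shows "qpoch q (a * b * c * d * q ^ (2 * j + m + n) / q) (m + n) * c_o a b c d q m n s =
    qbinom q (j + m + n) j * qpoch q (a * c * q ^ j) (m + n) / qpoch q (A * q ^ (2 * j)) (m + n) *
      (- d) ^ (m + n) * q ^ ((m + n) choose 2) *
    (qbinom q (m + n) m * qpoch q (- (a * c * q ^ j)) m * qpoch q (q * s / (c * d)) m * qpoch q (-
        b / a) m *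
      qpoch q (a * b * q ^ j * q ^ m) n * qpoch q (- (c / d * q / q ^ n)) n *
      qpoch q (- (a * c * q ^ j)) n * (- (a * c * q ^ j)) ^ m)"
proof -
  let ?r = "m + n" and ?Q = "q\<^sup>2"
  note nz = q_nonzero a_nonzero c_nonzero b d
  have snz: "s \<noteq> 0" using s by auto
  have sq: "s = 1 / (q ^ j * q ^ m * q ^ n)"
    using s nz by (simp add: power_add field_simps)
  have Qp: "?Q ^ n = q ^ n * q ^ n" for n
    by (simp add: power2_eq_square power_mult_distrib)
  define G where "G = a * b * c * d * q ^ (2 * j + m + n) / q"
  define T where "T n = q ^ (n choose 2)" for n
  define h where "h = a * c * q ^ j"
  have ac2: "a\<^sup>2 * c\<^sup>2 = A" by (simp add: A_def)
  note simps = Qp power_add power_double power2_eq_square power_mult_distrib A_def G_def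
  have S1: "qpoch q s ?r = (- s) ^ ?r * T ?r * (qpoch q q (j + m + n) / qpoch q q j)"
  proof -
    have "qpoch q q (j + m + n) = qpoch q q j * qpoch q (q ^ Suc j) ?r"
      using qpoch_add[of q q j ?r] by (simp add: add.assoc mult.commute)
    moreover have "qpoch q s ?r = (- s) ^ ?r * T ?r * qpoch q (q ^ Suc j) ?r"
      unfolding T_def by (rule qpoch_reverse) (use s q_nonzero in \<open>simp_all add: power_add mult_ac\<close>)
    ultimately show ?thesis by simp
  qed
  have S2: "qpoch q (q * s\<^sup>2 / A) ?r / qpoch q (q\<^sup>2 * s\<^sup>2 / (a * b * c * d)) ?r =
     ((q * s\<^sup>2 / A) / (q\<^sup>2 * s\<^sup>2 / (a * b * c * d))) ^ ?r * (qpoch q (A * q ^ (2 * j + ?r)) ?r /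
         qpoch q G ?r)"
  proof (rule qpoch_reverse_divide)
    show "q * s\<^sup>2 / A * (A * q ^ (2 * j + (m + n))) * q ^ (m + n) = q"
      unfolding sq using nz by (simp add: simps)
    show "q\<^sup>2 * s\<^sup>2 / (a * b * c * d) * G * q ^ (m + n) = q"
      unfolding sq using nz by (simp add: simps)
  qed (rule q_nonzero)
  have S3: "qpoch q (q * s / (a * b)) n = (- (q * s / (a * b))) ^ n * T n * qpoch q (a * b * q ^ j *
      q ^ m) n"
    unfolding T_def by (rule qpoch_reverse) (unfold sq, use nz in \<open>simp_all add: simps\<close>)
  have S4: "qpoch q (- (q ^ (m + 1) * s / (a * c))) n / qpoch q (- (q * s / (a * c))) n =
     ((- (q ^ (m + 1) * s / (a * c))) / (- (q * s / (a * c)))) ^ n * (qpoch q (- h) n / qpoch q (-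
         (a * c * q ^ (j + m))) n)"
  proof (rule qpoch_reverse_divide)
    show "- (q ^ (m + 1) * s / (a * c)) * - h * q ^ n = q"
      unfolding sq h_def using nz by (simp add: simps)
    show "- (q * s / (a * c)) * - (a * c * q ^ (j + m)) * q ^ n = q"
      unfolding sq using nz by (simp add: simps)
  qed (rule q_nonzero)
  have S5: "qpoch ?Q (q * s\<^sup>2 / A) ?r = (- (q * s\<^sup>2 / A)) ^ ?r * (T ?r)\<^sup>2 * qpoch ?Q (A * q ^ (2 *
      j + 1)) ?r"
  proof -
    have "(T ?r)\<^sup>2 = ?Q ^ (?r choose 2)" by (simp only: T_def power_mult[symmetric] mult.commute)
    moreover have "qpoch ?Q (q * s\<^sup>2 / A) ?r = (- (q * s\<^sup>2 / A)) ^ ?r * ?Q ^ (?r choose 2) *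
        qpoch ?Q (A * q ^ (2 * j + 1)) ?r"
      by (rule qpoch_reverse) (unfold sq, use nz in \<open>simp_all add: simps\<close>)
    ultimately show ?thesis by simp
  qed
  have S6: "qpoch q (- (c / d * q / q ^ n)) n = (c / d * q / q ^ n) ^ n * T n * qpoch q (- d / c) n"
    using qpoch_reverse[of "- (c / d * q / q ^ n)" "- d / c" q n] nz by (simp add: T_def)
  have S7: "qpoch q (- h) ?r = qpoch q (- h) m * qpoch q (- (a * c * q ^ (j + m))) n"
    unfolding qpoch_add by (simp add: h_def power_add mult_ac)
  have n1: "qpoch q (- (a * c * q ^ (j + m))) n \<noteq> 0"
    by (rule qpoch_minus_ac_nonzero)
  have n2: "qpoch q G ?r \<noteq> 0"
  proof -
    have "q ^ i * G \<noteq> 1" if i: "i < ?r" for i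
    proof -
      obtain t where t: "?r = Suc t" using i by (cases ?r) auto
      have "q ^ (2 * j + m + n) = q * q ^ (2 * j + t)"
        unfolding add.assoc t by simp
      then have "G = a * b * c * d * q ^ (2 * j + t)"
        unfolding G_def using nz by simp
      then have "q ^ i * G = a * b * c * d * q ^ (i + (2 * j + t))"
        by (simp add: power_add mult_ac)
      then show ?thesis using abcd by simp
    qed
    then show ?thesis by (auto simp: qpoch_eq_0_iff)
  qed
  let ?p = "(- s) ^ ?r * T ?r * ((q * s\<^sup>2 / A) / (q\<^sup>2 * s\<^sup>2 / (a * b * c * d))) ^ ?r * ((- (q * s /
      (a * b))) ^ n * T n) *
     ((- (q ^ (m + 1) * s / (a * c))) / (- (q * s / (a * c)))) ^ n / ((- (q * s\<^sup>2 / A)) ^ ?r *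
         (T ?r)\<^sup>2) * (q / b) ^ m * (q / d) ^ n"
  \<comment> \<open>The base \<open>b1\<close> of exponent m + n is distributed over m and n, which
    gives \<open>b3\<close> and \<open>b4\<close>; \<open>power_choose_two_square\<close> accounts
    for the remaining powers of q.\<close>
  have pw: "?p = (- d) ^ ?r * T ?r * (- h) ^ m * ((c / d * q / q ^ n) ^ n * T n)"
  proof -
    define X Y Z where "X = q ^ j" and "Y = q ^ m" and "Z = q ^ n"
    have XYZ: "X \<noteq> 0" "Y \<noteq> 0" "Z \<noteq> 0" using nz by (simp_all add: X_def Y_def Z_def)
    have s': "s = 1 / (X * Y * Z)" by (simp add: sq X_def Y_def Z_def)
    have Tnz: "T ?r \<noteq> 0" using nz by (simp add: T_def)
    have T2: "(T ?r)\<^sup>2 * (q ^ m * q ^ n) = (Y * Z) ^ m * (Y * Z) ^ n"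
      using power_choose_two_square[of q ?r] by (simp only: T_def Y_def Z_def power_add)
    have b1: "- s * ((q * s\<^sup>2 / A) / (q\<^sup>2 * s\<^sup>2 / (a * b * c * d))) / - (q * s\<^sup>2 / A) = a * b * c *
        d * (X * Y * Z) / q\<^sup>2"
      using nz XYZ by (simp add: s' A_def field_simps power2_eq_square)
    have b2: "- (q ^ (m + 1) * s / (a * c)) / - (q * s / (a * c)) = Y"
      using nz snz by (simp add: Y_def)
    have b3: "a * b * c * d * (X * Y * Z) / q\<^sup>2 * (q / b) = a * c * d * X * (Y * Z / q)"
      using nz by (simp add: field_simps power2_eq_square)
    have b4: "a * b * c * d * (X * Y * Z) / q\<^sup>2 * - (q * s / (a * b)) * (q / d) = - c"
      using nz XYZ by (simp add: s' field_simps power2_eq_square)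
    have "?p = (- s * ((q * s\<^sup>2 / A) / (q\<^sup>2 * s\<^sup>2 / (a * b * c * d))) / - (q * s\<^sup>2 / A)) ^ ?r *
       (- (q * s / (a * b))) ^ n * Y ^ n * (q / b) ^ m * (q / d) ^ n * T n / T ?r"
      unfolding b2 power_mult_distrib power_divide using Tnz snz by (simp add: power2_eq_square mult_ac)
    also have "\<dots> = (a * b * c * d * (X * Y * Z) / q\<^sup>2 * (q / b)) ^ m *
       (a * b * c * d * (X * Y * Z) / q\<^sup>2 * - (q * s / (a * b)) * (q / d)) ^ n * Y ^ n * T n / T ?r"
      unfolding b1 power_add power_mult_distrib by (simp only: mult_ac)
    also have "\<dots> = (a * c * d * X) ^ m * (- c) ^ n * T n * ((Y * Z / q) ^ m * Y ^ n / T ?r)"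
      unfolding b3 b4 power_mult_distrib by simp
    also have "(Y * Z / q) ^ m * Y ^ n / T ?r = (q / Z) ^ n * T ?r"
      using T2 Tnz nz XYZ by (simp add: power_divide power_mult_distrib field_simps power2_eq_square)
    also have "(a * c * d * X) ^ m * (- c) ^ n * T n * ((q / Z) ^ n * T ?r) =
       (- d * - (a * c * X)) ^ m * (- d * (c / d * q / Z)) ^ n * (T ?r * T n)"
    proof -
      have "- d * (c / d * q / Z) = - c * (q / Z)" "- d * - (a * c * X) = a * c * d * X"
        using nz by simp_all
      then show ?thesis by (simp only: power_mult_distrib mult_ac)
    qed
    also have "\<dots> = (- d) ^ ?r * T ?r * (- h) ^ m * ((c / d * q / q ^ n) ^ n * T n)"
      unfolding h_def X_def Z_def power_add power_mult_distrib[of "- d"] by (simp only: mult_ac)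
    finally show ?thesis .
  qed
  define P where "P = qpoch q (- b / a) m * qpoch q (q * s / (c * d)) m * qpoch q (- d / c) n /
      (qpoch q q m * qpoch q q n)"
  have regroup1: "p1 * s1 * p2 * w1 / (q1 * v1 * u1) * pb * (p3 * s2 * p4 * y1 * w2 / (q2 * v2 *
      z1 * u2)) * pd =
      p1 * p2 * p3 / (q1 * q2) * (s1 * s2) * (w1 * w2 / (v1 * v2)) * p4 * (y1 / z1) / (u1 * u2) *
          pb * pd"
    for p1 s1 p2 w1 q1 v1 u1 pb p3 s2 p4 y1 w2 q2 v2 z1 u2 pd :: complex
    by (simp add: divide_inverse mult_ac)
  have regroup2: "p * (k1 * y1) * (k2 * (v / g)) * (k3 * y3) * (k4 * y4) / (k5 * y5) * pb * pd =
      k1 * k2 * k3 * k4 / k5 * pb * pd * (p * y1 * (v / y5) * y3 * y4) / g"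
    for p k1 y1 k2 v g k3 y3 k4 y4 k5 y5 pb pd :: complex
    by (simp add: divide_inverse mult_ac)
  have cancel: "g * x = y" if "x = y / g" "g \<noteq> 0" for g x y :: complex
    using that by simp
  \<comment> \<open>Here x is (-ac q^(j+m); q)_n, which cancels between \<open>S7\<close> and
    \<open>S4\<close>.\<close>
  have regroup3: "e1 * e2 * e3 * e4 * (pb * pc * pd / (qm * qn) * (qL / qj) * (hc * (hm * x) / aj) *
      y * (hn / x)) =
      b1 * hc / aj * e1 * e2 * (b2 * hm * pc * pb * y * (e4 * pd) * hn * e3)"
    if "x \<noteq> 0" "b1 * b2 = qL / (qj * qm * qn)"
    for e1 e2 e3 e4 pb pc pd qm qn qL qj hc hm aj y hn x b1 b2 :: complex
  proof -
    have "b1 * hc / aj * e1 * e2 * (b2 * hm * pc * pb * y * (e4 * pd) * hn * e3) =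
      (b1 * b2) * (hc / aj * e1 * e2 * (hm * pc * pb * y * (e4 * pd) * hn * e3)) * (x / x)"
      using that(1) by (simp add: divide_inverse mult_ac)
    then show ?thesis unfolding that(2) by (simp only: divide_inverse inverse_mult_distrib mult_ac)
  qed
  have "c_o a b c d q m n s = P * qpoch q s ?r *
     (qpoch q (q * s\<^sup>2 / A) ?r / qpoch q (q\<^sup>2 * s\<^sup>2 / (a * b * c * d)) ?r) * qpoch q (q * s / (a *
         b)) n *
     (qpoch q (- (q ^ (m + 1) * s / (a * c))) n / qpoch q (- (q * s / (a * c))) n) / qpoch ?Q (q *
         s\<^sup>2 / A) ?r * (q / b) ^ m * (q / d) ^ n"
  proof -
    \<comment> \<open>A parameter shifted by q^m continues the product of length m, so each such
      pair merges into one product of length m + n.\<close>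
    have e: "qpoch q (q ^ (m + 1) * s\<^sup>2 / A) n = qpoch q (q ^ m * (q * s\<^sup>2 / A)) n"
      "qpoch q (q ^ (m + 2) * s\<^sup>2 / (a * b * c * d)) n = qpoch q (q ^ m * (q\<^sup>2 * s\<^sup>2 / (a * b * c *
          d))) n"
      "qpoch ?Q (q ^ (2 * m + 1) * s\<^sup>2 / A) n = qpoch ?Q (?Q ^ m * (q * s\<^sup>2 / A)) n"
      by (simp_all add: power_add power_double power_mult_distrib power2_eq_square mult_ac)
    show ?thesis
      unfolding c_o_def ac2 qpoch_add e P_def by (rule regroup1)
  qed
  also have "\<dots> = ?p * (P * (qpoch q q (j + m + n) / qpoch q q j) *
     (qpoch q (A * q ^ (2 * j + ?r)) ?r / qpoch ?Q (A * q ^ (2 * j + 1)) ?r) *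
     qpoch q (a * b * q ^ j * q ^ m) n * (qpoch q (- h) n / qpoch q (- (a * c * q ^ (j + m))) n)) /
         qpoch q G ?r"
    unfolding S1 S2 S3 S4 S5 by (rule regroup2)
  finally have "qpoch q G ?r * c_o a b c d q m n s = ?p * (P * (qpoch q q (j + m + n) / qpoch q q j) *
     (qpoch q (A * q ^ (2 * j + ?r)) ?r / qpoch ?Q (A * q ^ (2 * j + 1)) ?r) *
     qpoch q (a * b * q ^ j * q ^ m) n * (qpoch q (- h) n / qpoch q (- (a * c * q ^ (j + m))) n))"
    by (rule cancel[OF _ n2])
  also have "\<dots> = qbinom q (j + m + n) j * qpoch q h ?r / qpoch q (A * q ^ (2 * j)) ?r * (- d) ^ ?r *
      T ?r *
    (qbinom q ?r m * qpoch q (- h) m * qpoch q (q * s / (c * d)) m * qpoch q (- b / a) m *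
      qpoch q (a * b * q ^ j * q ^ m) n * ((c / d * q / q ^ n) ^ n * T n * qpoch q (- d / c) n) *
          qpoch q (- h) n * (- h) ^ m)"
    unfolding pw qpoch_A_double h_def[symmetric] S7 P_def
  proof (rule regroup3[OF n1])
    show "qbinom q (j + m + n) j * qbinom q ?r m = qpoch q q (j + m + n) / (qpoch q q j *
        qpoch q q m * qpoch q q n)"
      by (simp add: qbinom_def add.assoc)
  qed
  finally show ?thesis
    unfolding S6 T_def h_def G_def .
qed

section \<open>The coefficient of P_j in the Askey-Wilson polynomial\<close>

text \<open>With n = r - i the last bracket is the i-th term on the left of Sears' transformation of
  length r. The first factors depend on i and n only through r and coincide with those of
  \<open>c_o_eq\<close>, apart from (g; q)_j.\<close>

lemma aw_term_eq:
  assumes d: "d \<noteq> 0" and s: "s * q ^ (j + i + n) = 1"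
  shows "1 / a ^ (j + i + n) * (qpoch q s (j + i) * qpoch q g (j + i) / qpoch q q (j + i) * q ^ (j +
      i) *
      (qpoch q (a * b * q ^ (j + i)) n * qpoch q (a * c * q ^ (j + i)) n * qpoch q (a * d * q ^ (j +
          i)) n)) * U (j + i) j =
    qpoch q g j * (qbinom q (j + i + n) j * qpoch q (a * c * q ^ j) (i + n) / qpoch q (A * q ^ (2 *
        j)) (i + n) *
      (- d) ^ (i + n) * q ^ ((i + n) choose 2)) *
    (qbinom q (i + n) i * qpoch q (g * q ^ j) i * qpoch q (- (a\<^sup>2) * q ^ j) i * qpoch q (- (a * c *
        q ^ j)) i *
      qpoch q (a * b * q ^ j * q ^ i) n * qpoch q (A * q ^ (2 * j) * q ^ i) n *
      qpoch q (q * s / (a * d)) n * (q * s / (a * d)) ^ i)"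
proof -
  note nz = q_nonzero a_nonzero c_nonzero d
  have sq: "s = 1 / (q ^ j * q ^ i * q ^ n)"
    using s nz by (simp add: power_add field_simps)
  define T where "T n = q ^ (n choose 2)" for n
  have Tadd: "T (m + n) = T m * T n * (q ^ m) ^ n" for m n
    by (simp only: T_def choose_two_add power_add power_mult)
  have T2: "T j * T j * q ^ j = (q ^ j) ^ j"
    using power_choose_two_square[of q j] by (simp add: T_def power2_eq_square)
  have S1: "qpoch q s (j + i) = (- s) ^ (j + i) * T (j + i) * (qpoch q q (j + i + n) / qpoch q q n)"
  proof -
    have "qpoch q q (j + i + n) = qpoch q q n * qpoch q (q ^ Suc n) (j + i)"
      using qpoch_add[of q q n "j + i"] by (simp add: add.commute mult.commute)
    moreover have "qpoch q s (j + i) = (- s) ^ (j + i) * T (j + i) * qpoch q (q ^ Suc n) (j + i)"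
      unfolding T_def by (rule qpoch_reverse) (use s q_nonzero in \<open>simp_all add: power_add mult_ac\<close>)
    ultimately show ?thesis by simp
  qed
  have S2: "qpoch q (a * d * q ^ (j + i)) n = (- (a * d * q ^ (j + i))) ^ n * T n * qpoch q (q * s /
      (a * d)) n"
    unfolding T_def by (rule qpoch_reverse) (unfold sq, use nz in \<open>simp_all add: power_add\<close>)
  have S3: "qpoch q g (j + i) = qpoch q g j * qpoch q (g * q ^ j) i"
    by (simp add: qpoch_add mult.commute)
  have S4: "qpoch q (a * c * q ^ j) (i + n) = qpoch q (a * c * q ^ j) i * qpoch q (a * c * q ^ (j +
      i)) n"
    by (simp add: qpoch_add power_add mult_ac)
  have S5: "qpoch q (A * q ^ (2 * j)) (i + n) = qpoch q (A * q ^ (2 * j)) i * qpoch q (A * q ^ (2 *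
      j) * q ^ i) n"
    by (simp add: qpoch_add mult.commute)
  have S6: "qpoch (q\<^sup>2) (A * q ^ (2 * j)) i = qpoch q (a * c * q ^ j) i * qpoch q (- (a * c * q ^ j)) i"
    unfolding qpoch_mult_minus by (simp add: A_def power_mult_distrib power_even_eq)
  have S7: "qpoch q (A * q ^ (2 * j) * q ^ i) n \<noteq> 0"
    using qpoch_A_nonzero[of "2 * j + i" n] by (simp add: power_add mult_ac)
  have bin: "qpoch q q (j + i + n) / (qpoch q q n * qpoch q q (j + i)) * qbinom q (j + i) j =
     qbinom q (j + i + n) j * qbinom q (i + n) i"
    by (simp add: qbinom_def add.assoc)
  \<comment> \<open>All powers with exponent j cancel, because s = q^(-j-i-n).\<close>
  have pw: "1 / a ^ (j + i + n) * ((- s) ^ (j + i) * T (j + i)) * q ^ (j + i) * ((- (a * d *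
      q ^ (j + i))) ^ n * T n) * ((- a) ^ j * T j)
     = (- d) ^ (i + n) * T (i + n) * (q * s / (a * d)) ^ i"
  proof -
    define X Y Z where "X = q ^ j" and "Y = q ^ i" and "Z = q ^ n"
    have XYZ: "X \<noteq> 0" "Y \<noteq> 0" "Z \<noteq> 0" using nz by (simp_all add: X_def Y_def Z_def)
    have s': "s = 1 / (X * Y * Z)" by (simp add: sq X_def Y_def Z_def)
    have c1: "X ^ i = Y ^ j" "X ^ n = Z ^ j"
      by (simp_all add: X_def Y_def Z_def flip: power_mult) (simp_all add: mult.commute)
    have "1 / a ^ (j + i + n) * ((- s) ^ (j + i) * T (j + i)) * q ^ (j + i) * ((- (a * d * q ^ (j +
        i))) ^ n * T n) * ((- a) ^ j * T j)
      = 1 / (a ^ j * a ^ i * a ^ n) * ((- s) ^ j * (- s) ^ i * (T j * T i * X ^ i)) * (q ^ j *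
          q ^ i) * ((- (a * d * (X * Y))) ^ n * T n) * ((- a) ^ j * T j)"
      unfolding Tadd power_add X_def Y_def by (simp only: mult_ac)
    also have "\<dots> = (T j * T j * q ^ j) * (s * a / a) ^ j * X ^ i * X ^ n * ((- (q * s / a)) ^ i *
        ((- d) ^ n * Y ^ n) * T i * T n)"
    proof -
      have m1: "(- (a * d * (X * Y))) ^ n = (- d) ^ n * a ^ n * X ^ n * Y ^ n"
        "(- (q * s / a)) ^ i = (- s) ^ i * q ^ i / a ^ i"
        by (simp_all add: power_mult_distrib power_divide power_minus[of "a * d * (X * Y)"]
            power_minus[of "q * s / a"] power_minus[of d] power_minus[of s])
      have m2: "(- s) ^ j * (- a) ^ j = (s * a) ^ j"
        by (simp flip: power_mult_distrib)
      have "1 / (a ^ j * a ^ i * a ^ n) * ((- s) ^ j * (- s) ^ i * (T j * T i * X ^ i)) * (q ^ j *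
          q ^ i) *
          ((- d) ^ n * a ^ n * X ^ n * Y ^ n * T n) * ((- a) ^ j * T j) =
        (T j * T j * q ^ j) * (((- s) ^ j * (- a) ^ j) / a ^ j) * X ^ i * X ^ n *
          ((- s) ^ i * q ^ i / a ^ i * ((- d) ^ n * Y ^ n) * T i * T n)"
        using nz by simp
      then show ?thesis unfolding m1 m2 power_divide .
    qed
    also have "\<dots> = (X * Y * Z * s) ^ j * ((- (q * s / a)) ^ i * ((- d) ^ n * Y ^ n) * T i * T n)"
      unfolding T2 c1 using nz by (simp add: power_mult_distrib mult_ac X_def)
    also have "\<dots> = (- d * (q * s / (a * d))) ^ i * ((- d) ^ n * Y ^ n) * T i * T n"
      using nz XYZ by (simp add: s' mult.assoc)
    also have "\<dots> = (- d) ^ (i + n) * T (i + n) * (q * s / (a * d)) ^ i"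
      unfolding Tadd Y_def power_add power_mult_distrib by (simp only: mult_ac)
    finally show ?thesis .
  qed
  have regroup1: "w * (k1 * (qL / qn) * (gj * gi) / qk * k2 * (ab * ac * (k3 * v))) * (qb * k4 *
      k5 * m1 * (m2 * m3) / m4) =
      (w * k1 * k2 * k3 * (k4 * k5)) * (qL / (qn * qk) * qb) * (gj * gi * ab * ac * v * m1 * (m2 *
          m3) / m4)"
    for w k1 qL qn gj gi qk k2 ab ac k3 v qb k4 k5 m1 m2 m3 m4 :: complex
    by (simp only: divide_inverse inverse_mult_distrib mult_ac)
  \<comment> \<open>Here x is (A q^(2j+i); q)_n; inserting x / x extends the denominator of
    \<open>U\<close> to length i + n.\<close>
  have regroup2: "e1 * e2 * e3 * (b1 * b2) * (gj * gi * ab * ac * v * m1 * (m2 * m3) / m4) =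
      gj * (b1 * (m2 * ac) / (m4 * x) * e1 * e2) * (b2 * gi * m1 * m3 * ab * x * v * e3)" if "x \<noteq> 0"
    for e1 e2 e3 b1 b2 gj gi ab ac v m1 m2 m3 m4 x :: complex
  proof -
    have "e1 * e2 * e3 * (b1 * b2) * (gj * gi * ab * ac * v * m1 * (m2 * m3) / m4) =
      e1 * e2 * e3 * (b1 * b2) * (gj * gi * ab * ac * v * m1 * (m2 * m3) / m4) * (x / x)"
      using that by simp
    then show ?thesis by (simp only: divide_inverse inverse_mult_distrib mult_ac)
  qed
  have ab: "qpoch q (a * b * q ^ (j + i)) n = qpoch q (a * b * q ^ j * q ^ i) n"
    by (simp add: power_add mult_ac)
  show ?thesis
    unfolding S1 S2 S3 S4 S5 ab U_def T_def[symmetric] add_diff_cancel_left' S6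
    unfolding regroup1 pw bin by (rule regroup2[OF S7])
qed

text \<open>Sears' transformation with B = g q^j, C = -a^2 q^j and D = h = -ac q^j turns the sum
  over i into the sum of \<open>c_o\<close>.\<close>

lemma aw_coefficient:
  assumes b: "b \<noteq> 0" and d: "d \<noteq> 0" and abcd: "\<And>n. a * b * c * d * q ^ n \<noteq> 1"
    and s: "s * q ^ (j + r) = 1" and g: "g = a * b * c * d * q ^ (j + r) / q"
  shows "(\<Sum>i\<le>r. 1 / a ^ (j + r) * (qpoch q s (j + i) * qpoch q g (j + i) / qpoch q q (j + i) *
      q ^ (j + i) *
      (qpoch q (a * b * q ^ (j + i)) (r - i) * qpoch q (a * c * q ^ (j + i)) (r - i) * qpoch q (a *
          d * q ^ (j + i)) (r - i))) * U (j + i) j) =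
    qpoch q g (j + r) * (\<Sum>m\<le>r. c_o a b c d q m (r - m) s)"
proof -
  note nz = q_nonzero a_nonzero c_nonzero b d
  have snz: "s \<noteq> 0" using s by auto
  define h where "h = - (a * c * q ^ j)"
  \<comment> \<open>Determined by BCt = ab q^j. Then th = qs/(ad), and the transformed parameters Bt
    and Ct become -b/a and qs/(cd), as in \<open>c_o\<close>.\<close>
  define t where "t = - (q * s / (q ^ j * a\<^sup>2 * c * d))"
  define K where "K = qbinom q (j + r) j * qpoch q (a * c * q ^ j) r / qpoch q (A * q ^ (2 * j)) r *
      (- d) ^ r * q ^ (r choose 2)"
  have tnz: "t \<noteq> 0" using nz snz by (simp add: t_def)
  have g': "g * s = a * b * c * d / q" using s by (simp add: g mult_ac)
  have e1: "g * q ^ j * (- (a\<^sup>2) * q ^ j) * t = a * b * q ^ j"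
  proof -
    have "g * q ^ j * (- (a\<^sup>2) * q ^ j) * t = (g * s) * (q * q ^ j / (c * d))"
      using nz by (simp add: t_def field_simps)
    then show ?thesis unfolding g' using nz by simp
  qed
  have e2: "h * h = A * q ^ (2 * j)"
    by (simp add: h_def A_def power_double power2_eq_square mult_ac)
  have e3: "t * h = q * s / (a * d)"
    using nz by (simp add: t_def h_def power2_eq_square)
  have e4: "- (a\<^sup>2) * q ^ j * t = q * s / (c * d)"
    using nz by (simp add: t_def)
  have e5: "g * q ^ j * t = - b / a"
  proof -
    have "g * q ^ j * t = - (g * s) * (q / (a\<^sup>2 * c * d))"
      using nz by (simp add: t_def field_simps)
    then show ?thesis unfolding g' using nz by (simp add: field_simps power2_eq_square)
  qed
  have e6: "h * t * h * q ^ m = - (c / d * q / q ^ (r - m))" if "m \<le> r" for m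
  proof -
    have "q ^ (j + r) = q ^ j * q ^ m * q ^ (r - m)" using that by (simp flip: power_add)
    then have sq: "s = 1 / (q ^ j * q ^ m * q ^ (r - m))" using s nz by (simp add: field_simps)
    have "h * t * h * q ^ m = h * q ^ m * (q * s / (a * d))" using e3 by (simp add: mult_ac)
    then show ?thesis using nz by (simp add: sq h_def)
  qed
  have "(\<Sum>i\<le>r. 1 / a ^ (j + r) * (qpoch q s (j + i) * qpoch q g (j + i) / qpoch q q (j + i) *
      q ^ (j + i) *
      (qpoch q (a * b * q ^ (j + i)) (r - i) * qpoch q (a * c * q ^ (j + i)) (r - i) * qpoch q (a *
          d * q ^ (j + i)) (r - i))) * U (j + i) j) =
    (\<Sum>i\<le>r. qpoch q g j * K * (qbinom q r i * qpoch q (g * q ^ j) i * qpoch q (- (a\<^sup>2) * q ^ j) i *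
        qpoch q h i *
      qpoch q (g * q ^ j * (- (a\<^sup>2) * q ^ j) * t * q ^ i) (r - i) * qpoch q (h * h * q ^ i) (r - i) *
      qpoch q (t * h) (r - i) * (t * h) ^ i))"
    unfolding e1 e2 e3
  proof (rule sum.cong[OF refl])
    fix i assume "i \<in> {..r}"
    then have r: "r = i + (r - i)" "j + r = j + i + (r - i)" by auto
    from aw_term_eq[OF d, of s j i "r - i" g b] s
    show "1 / a ^ (j + r) * (qpoch q s (j + i) * qpoch q g (j + i) / qpoch q q (j + i) * q ^ (j + i) *
      (qpoch q (a * b * q ^ (j + i)) (r - i) * qpoch q (a * c * q ^ (j + i)) (r - i) * qpoch q (a *
          d * q ^ (j + i)) (r - i))) * U (j + i) j =
      qpoch q g j * K * (qbinom q r i * qpoch q (g * q ^ j) i * qpoch q (- (a\<^sup>2) * q ^ j) i *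
          qpoch q h i *
      qpoch q (a * b * q ^ j * q ^ i) (r - i) * qpoch q (A * q ^ (2 * j) * q ^ i) (r - i) *
      qpoch q (q * s / (a * d)) (r - i) * (q * s / (a * d)) ^ i)"
      unfolding K_def h_def r(2)[symmetric] r(1)[symmetric] by blast
  qed
  also have "\<dots> = qpoch q g j * K * (\<Sum>m\<le>r. qbinom q r m * qpoch q h m * qpoch q (q * s / (c * d)) m *
      qpoch q (- b / a) m *
      qpoch q (a * b * q ^ j * q ^ m) (r - m) * qpoch q (h * t * h * q ^ m) (r - m) *
      qpoch q h (r - m) * h ^ m)"
    unfolding sum_distrib_left[symmetric] by (subst sears_transformation[OF tnz]) (simp only: e1 e4 e5)
  also have "\<dots> = qpoch q g j * (\<Sum>m\<le>r. K * (qbinom q r m * qpoch q h m * qpoch q (q * s / (c *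
      d)) m * qpoch q (- b / a) m *
      qpoch q (a * b * q ^ j * q ^ m) (r - m) * qpoch q (h * t * h * q ^ m) (r - m) *
      qpoch q h (r - m) * h ^ m))"
    unfolding mult.assoc[of "qpoch q g j"] sum_distrib_left[of K] ..
  \<comment> \<open>By \<open>e6\<close> each term is the right side of \<open>c_o_eq\<close> with n
    = r - m; afterwards (g; q)_j and (g q^j; q)_r merge.\<close>
  also have "\<dots> = qpoch q g j * (\<Sum>m\<le>r. qpoch q (g * q ^ j) r * c_o a b c d q m (r - m) s)"
  proof (intro arg_cong[where f = "(*) (qpoch q g j)"] sum.cong[OF refl])
    fix m assume "m \<in> {..r}"
    then have m: "m \<le> r" and r: "m + (r - m) = r" "j + m + (r - m) = j + r" "2 * j + m + (r - m) =
        j + (j + r)" by auto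
    have G: "a * b * c * d * q ^ (j + (j + r)) / q = g * q ^ j"
      by (simp add: g power_add mult_ac)
    have "s * q ^ (j + m + (r - m)) = 1" unfolding r by (rule s)
    from c_o_eq[OF b d abcd this]
    show "K * (qbinom q r m * qpoch q h m * qpoch q (q * s / (c * d)) m * qpoch q (- b / a) m *
      qpoch q (a * b * q ^ j * q ^ m) (r - m) * qpoch q (h * t * h * q ^ m) (r - m) *
      qpoch q h (r - m) * h ^ m) = qpoch q (g * q ^ j) r * c_o a b c d q m (r - m) s"
      unfolding r G K_def[symmetric] h_def[symmetric] e6[OF m] ..
  qed
  also have "\<dots> = qpoch q g (j + r) * (\<Sum>m\<le>r. c_o a b c d q m (r - m) s)"
    by (simp add: qpoch_add sum_distrib_left mult_ac)
  finally show ?thesis .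
qed

section \<open>Assembly of the fourfold sum\<close>

text \<open>The two expansions are composed. A Rogers polynomial of degree M = j - 2l contributes
  the exponents 2k - M = 2k + 2l - j.\<close>

lemma monic_rec_eq_c_e:
  assumes "x \<noteq> 0"
  shows "monic_rec \<gamma> (x + 1 / x) j = (\<Sum>l | 2 * l \<le> j. \<Sum>k\<le>j - 2 * l.
    c_e a c q k l (q powi (- int j)) * x powi (2 * int k + 2 * int l - int j))"
proof -
  interpret sq: qbase "q\<^sup>2" by (rule qbase_square)
  have "a\<^sup>2 * (q\<^sup>2) ^ n \<noteq> 1" for n
    using a_generic[of "2 * n"] by (simp add: power_mult)
  then have "monic_rec \<gamma> (x + 1 / x) j = (\<Sum>l | 2 * l \<le> j. D (j - 2 * l) l * sq.rogers (a\<^sup>2) (j - 2 *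
      l) x)"
    using monic_rec_even[OF assms] sq.monic_rec_rogers[of "a\<^sup>2", OF _ assms] by simp
  also have "\<dots> = (\<Sum>l | 2 * l \<le> j. \<Sum>k\<le>j - 2 * l.
    c_e a c q k l (q powi (- int j)) * x powi (2 * int k + 2 * int l - int j))"
    unfolding sq.rogers_def sum_distrib_left
  proof (intro sum.cong refl)
    fix l k assume "l \<in> {l. 2 * l \<le> j}" "k \<in> {..j - 2 * l}"
    then have l: "2 * l \<le> j" and k: "k \<le> j - 2 * l" by auto
    have "q powi (- int j) * q ^ (j - 2 * l + 2 * l) = 1"
      using l q_nonzero by (simp add: power_int_minus)
    from c_e_eq[OF this k] l
    show "D (j - 2 * l) l * (sq.rogers_coeff (a\<^sup>2) (j - 2 * l) k * x powi (2 * int k - int (j - 2 *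
        l))) =
      c_e a c q k l (q powi (- int j)) * x powi (2 * int k + 2 * int l - int j)"
      by (simp add: of_nat_diff algebra_simps)
  qed
  finally show ?thesis .
qed

end

text \<open>For fixed m, the relation j + m + n = N exchanges the degree j for the index n.\<close>

lemma sum_P_set:
  "(\<Sum>j\<le>N. \<Sum>m\<le>N - j. \<Sum>l | 2 * l \<le> j. \<Sum>k\<le>j - 2 * l. f j m l k) =
   (\<Sum>(k, l, m, n) \<in> P_set N. f (N - m - n) m l k)" for f :: "nat \<Rightarrow> nat \<Rightarrow> nat \<Rightarrow> nat \<Rightarrow> complex"
proof -
  have fin: "finite {l. 2 * l \<le> j}" for j :: nat
    by (rule finite_subset[of _ "{..j}"]) auto
  have "(\<Sum>j\<le>N. \<Sum>m\<le>N - j. \<Sum>l | 2 * l \<le> j. \<Sum>k\<le>j - 2 * l. f j m l k) =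
    (\<Sum>(j, m, l, k) \<in> (SIGMA j:{..N}. SIGMA m:{..N - j}. SIGMA l:{l. 2 * l \<le> j}. {..j - 2 *
        l}). f j m l k)"
    using fin by (simp add: sum.Sigma finite_SigmaI)
  also have "\<dots> = (\<Sum>(k, l, m, n) \<in> P_set N. f (N - m - n) m l k)"
    by (rule sum.reindex_bij_witness[where i = "\<lambda>(k, l, m, n). (N - m - n, m, l, k)"
          and j = "\<lambda>(j, m, l, k). (k, l, m, N - j - m)"]) (auto simp: P_set_def)
  finally show ?thesis .
qed

theorem theorem1p6:
  fixes a b c d q x :: complex and lam :: nat
  assumes "norm q < 1"
    and "aw_generic a b c d q"
    and "x \<noteq> 0"
  shows "askey_wilson a b c d q lam x =
    qpoch q (a*b*c*d * q powi (int lam - 1)) lam *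
    (\<Sum>(k, l, m, n) \<in> P_set lam.
      c_e a c q k l (q powi (int m + int n - int lam)) *
      c_o a b c d q m n (q powi (- int lam)) *
      x powi (- int lam + 2 * int k + 2 * int l + int m + int n))"
proof -
  have nz: "a \<noteq> 0" "b \<noteq> 0" "c \<noteq> 0" "d \<noteq> 0" "q \<noteq> 0"
    and gen: "\<And>j. a\<^sup>2 * q ^ j \<noteq> 1" "\<And>j. a * b * q ^ j \<noteq> 1" "\<And>j. a * d * q ^ j \<noteq> 1"
      "\<And>j. a * b * c * d * q ^ j \<noteq> 1" "\<And>j. a\<^sup>2 * c\<^sup>2 * q ^ j \<noteq> 1"
    using assms(2) by (auto simp: aw_generic_def)
  have "q ^ n \<noteq> 1" if "0 < n" for n
  proof
    assume "q ^ n = 1"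
    then have "norm q ^ n = 1" by (simp flip: norm_power)
    moreover have "norm q ^ n < 1" using assms(1) that by (simp add: power_less_one_iff)
    ultimately show False by simp
  qed
  then interpret even_aw q a c
    using nz gen by unfold_locales auto
  define s where "s = q powi (- int lam)"
  define g where "g = a * b * c * d * q powi (int lam - 1)"
  have s: "s * q ^ lam = 1" using nz by (simp add: s_def power_int_minus)
  have g: "g = a * b * c * d * q ^ lam / q" using nz by (simp add: g_def power_int_diff)
  have ac: "a * c * q ^ j \<noteq> 1" for j
  proof
    assume "a * c * q ^ j = 1"
    then have "(a * c * q ^ j)\<^sup>2 = 1" by simp
    then have "a\<^sup>2 * c\<^sup>2 * q ^ (2 * j) = 1" by (simp add: power_mult_distrib power_even_eq)
    then show False using gen(5) by blast
  qed
  have pnz: "qpoch q y k \<noteq> 0" if "\<And>j. y * q ^ j \<noteq> 1" for y k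
    using that by (simp add: qpoch_eq_0_iff mult.commute)
  \<comment> \<open>The coefficient of (ax, a/x; q)_k: the quotient (ab; q)_lam / (ab; q)_k is
    written as its tail (ab q^k; q)_(lam-k), likewise for ac and ad.\<close>
  define cf where "cf k = 1 / a ^ lam * (qpoch q s k * qpoch q g k / qpoch q q k * q ^ k *
      (qpoch q (a * b * q ^ k) (lam - k) * qpoch q (a * c * q ^ k) (lam - k) * qpoch q (a * d *
          q ^ k) (lam - k)))" for k
  let ?P = "monic_rec \<gamma> (x + 1 / x)"
  \<comment> \<open>Since s = q^(-lam), the series stops at k = lam.\<close>
  have "qpoch q s k = 0" if "lam < k" for k
    using s that by (auto simp: qpoch_eq_0_iff mult.commute)
  then have "phi43 s g (a * x) (a / x) (a * b) (a * c) (a * d) q q =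
    (\<Sum>k\<le>lam. qpochs q [s, g, a * x, a / x] k / qpochs q [q, a * b, a * c, a * d] k * q ^ k)"
    unfolding phi43_def by (intro suminf_finite) (auto simp: qpochs_def)
  then have "askey_wilson a b c d q lam x = (\<Sum>k\<le>lam. 1 / a ^ lam * qpochs q [a * b, a * c, a * d] lam *
      (qpochs q [s, g, a * x, a / x] k / qpochs q [q, a * b, a * c, a * d] k * q ^ k))"
    unfolding askey_wilson_def s_def[symmetric] g_def[symmetric]
    by (simp add: power_int_minus sum_distrib_left inverse_eq_divide)
  also have "\<dots> = (\<Sum>k\<le>lam. cf k * (qpoch q (a * x) k * qpoch q (a / x) k))"
  proof (rule sum.cong[OF refl])
    fix k assume "k \<in> {..lam}"
    then have split: "qpoch q y lam = qpoch q y k * qpoch q (y * q ^ k) (lam - k)" for y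
      using qpoch_add[of q y k "lam - k"] by (simp add: mult.commute)
    show "1 / a ^ lam * qpochs q [a * b, a * c, a * d] lam *
      (qpochs q [s, g, a * x, a / x] k / qpochs q [q, a * b, a * c, a * d] k * q ^ k) =
      cf k * (qpoch q (a * x) k * qpoch q (a / x) k)"
      using pnz[OF gen(2), of k] pnz[OF ac, of k] pnz[OF gen(3), of k]
      by (simp add: qpochs_def split[of "a * _"] cf_def)
  qed
  also have "\<dots> = (\<Sum>k\<le>lam. \<Sum>j\<le>k. cf k * U k j * ?P j)"
    unfolding shifted_power_expansion[OF assms(3)] by (simp add: sum_distrib_left mult.assoc)
  also have "\<dots> = (\<Sum>j\<le>lam. \<Sum>i\<le>lam - j. cf (j + i) * U (j + i) j * ?P j)"
    by (rule sum_triangle_shift)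
  also have "\<dots> = (\<Sum>j\<le>lam. qpoch q g lam * (\<Sum>m\<le>lam - j. c_o a b c d q m (lam - j - m) s) * ?P j)"
  proof (rule sum.cong[OF refl])
    fix j assume "j \<in> {..lam}"
    then have j: "j + (lam - j) = lam" by simp
    have "(\<Sum>i\<le>lam - j. cf (j + i) * U (j + i) j) = qpoch q g lam * (\<Sum>m\<le>lam -
        j. c_o a b c d q m (lam - j - m) s)"
      using aw_coefficient[OF nz(2,4) gen(4), of s j "lam - j" g] s g
      unfolding j by (simp add: cf_def)
    then show "(\<Sum>i\<le>lam - j. cf (j + i) * U (j + i) j * ?P j) =
      qpoch q g lam * (\<Sum>m\<le>lam - j. c_o a b c d q m (lam - j - m) s) * ?P j"
      by (simp flip: sum_distrib_right)
  qed
  also have "\<dots> = qpoch q g lam * (\<Sum>j\<le>lam. \<Sum>m\<le>lam - j. c_o a b c d q m (lam - j - m) s * ?P j)"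
    by (simp only: sum_distrib_left sum_distrib_right mult.assoc)
  also have "\<dots> = qpoch q g lam * (\<Sum>j\<le>lam. \<Sum>m\<le>lam - j. \<Sum>l | 2 * l \<le> j. \<Sum>k\<le>j - 2 * l.
      c_e a c q k l (q powi (- int j)) * c_o a b c d q m (lam - j - m) s * x powi (2 * int k + 2 *
          int l - int j))"
    unfolding monic_rec_eq_c_e[OF assms(3)] by (simp add: sum_distrib_left mult_ac)
  also have "\<dots> = qpoch q g lam * (\<Sum>(k, l, m, n) \<in> P_set lam.
      c_e a c q k l (q powi (int m + int n - int lam)) * c_o a b c d q m n s *
      x powi (- int lam + 2 * int k + 2 * int l + int m + int n))"
    unfolding sum_P_set
  proof (intro arg_cong[where f = "(*) (qpoch q g lam)"] sum.cong[OF refl])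
    fix p assume "p \<in> P_set lam"
    moreover obtain k l m n where p: "p = (k, l, m, n)" by (cases p)
    ultimately have "m + n \<le> lam" by (simp add: P_set_def)
    \<comment> \<open>In the set m + n <= lam, so the natural subtractions are not
      truncated.\<close>
    then have "- int (lam - m - n) = int m + int n - int lam" "lam - (lam - m - n) - m = n"
      "2 * int k + 2 * int l - int (lam - m - n) = - int lam + 2 * int k + 2 * int l + int m + int n"
      by auto
    then show "(case p of (k, l, m, n) \<Rightarrow> c_e a c q k l (q powi (- int (lam - m - n))) *
        c_o a b c d q m (lam - (lam - m - n) - m) s * x powi (2 * int k + 2 * int l - int (lam -
            m - n))) =
      (case p of (k, l, m, n) \<Rightarrow> c_e a c q k l (q powi (int m + int n - int lam)) * c_o a b c d q m n s *
        x powi (- int lam + 2 * int k + 2 * int l + int m + int n))"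
      unfolding p prod.case by (simp only:)
  qed
  finally show ?thesis unfolding s_def g_def .
qed

end
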